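(* Let $\Sigma$ be a finite alphabet, $M$ a finite monoid, $\varphi:\Sigma^*\to M$ a homomorphism and $m\in\mathbb{N}_0$. Let $m_u,m_v\in M$ be fixed and let $(u_n,v_n)_{n\in\mathbb{N}_0}$ be an infinite sequence of pairs of finite words $u_n,v_n\in\Sigma^*$ such that for all $n\in\mathbb{N}_0$: $u_n\equiv_{m,n}^X v_n$, $\varphi(u_n)=m_u$ and $\varphi(v_n)=m_v$. Then there are $\pi$-terms $\alpha$ and $\beta$ over $\Sigma$ such that $\varphi([\![\alpha]\!]_{M!})=m_u$, $\varphi([\![\beta]\!]_{M!})=m_v$ and $[\![\alpha]\!]_{\omega+\omega^*}\equiv_m^X[\![\beta]\!]_{\omega+\omega^*}$ hold.
   Context: $\mathbb{N}=\{1,2,\dots\}$, $\mathbb{N}_0=\{0,1,\dots\}$. For a finite monoid $M$, $M!$ is the smallest $n\in\mathbb{N}$ such that $x^n$ is idempotent for all $x\in M$. Generalized words. A (generalized) word over $\Sigma$ is a map $w:\mathrm{dom}(w)\to\Sigma$ from a linearly ordered set (up to isomorphism); finite words are the case of finite $\mathrm{dom}(w)$. Concatenation $uv$ has domain the ordered sum. For an order type $\nu$ with underlying order $P_\nu$, $w^\nu$ has domain $\mathrm{dom}(w)\times P_\nu$ ordered by the second coordinate first, then by the first, with $(p,q)\mapsto w(p)$. $\omega+\omega^*$ is the order type of $\mathbb{N}\uplus(-\mathbb{N})$ ordered as $1,2,3,\dots\ \dots,-3,-2,-1$. $\mathrm{alph}(w)$ is the image of $w$. A word is accessible if for every position $p$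 (including $p=\pm\infty$) and letter $a$: whenever there is an $a$-position strictly right of $p$ there is a smallest one, and whenever there is an $a$-position strictly left of $p$ there is a largest one. Finite words and all words $[\![\gamma]\!]_{\omega+\omega^*}$ are accessible. $\pi$-terms. $\pi$-terms over $\Sigma$: $\varepsilon$ and each $a\in\Sigma$ are $\pi$-terms; if $\alpha,\beta$ are $\pi$-terms so are $\alpha\beta$ and $(\alpha)^\pi$. For an order type $\mu$ (in particular a natural number): $[\![\varepsilon]\!]_\mu=\varepsilon$, $[\![a]\!]_\mu=a$, $[\![\alpha\beta]\!]_\mu=[\![\alpha]\!]_\mu[\![\beta]\!]_\mu$, $[\![(\alpha)^\pi]\!]_\mu=([\![\alpha]\!]_\mu)^\mu$. Relations on accessible words. For $a\in\mathrm{alph}(w)$, $w\cdot X_a^L$, $w\cdot X_a^R$ are the factors of $w$ strictly left/right of the first $a$; $w\cdot Y_a^L$, $w\cdot Y_a^R$ those strictly left/right of the last $a$. $u\equiv_{m,n}^Z v$ always holds if $m=0$ or $n=0$ ($Z\in\{X,Y\}$). For $m,n\in\mathbb{N}$: - $u\equiv_{m,n}^X v$ iff $\mathrm{alph}(u)=\mathrm{alph}(v)$, $u\equiv_{m-1,n-1}^Y v$, and for all $a\in\mathrm{alph}(u)$: $u\cdot X_a^L\equiv_{m-1,n-1}^Y v\cdot X_a^L$ and $u\cdot X_a^R\equiv_{m,n-1}^X v\cdot X_a^R$; - $u\equiv_{m,n}^Y v$ iff $\mathrm{alph}(u)=\mathrm{alph}(v)$, $u\equiv_{m-1,n-1}^X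 v$, and for all $a\in\mathrm{alph}(u)$: $u\cdot Y_a^L\equiv_{m,n-1}^Y v\cdot Y_a^L$ and $u\cdot Y_a^R\equiv_{m-1,n-1}^X v\cdot Y_a^R$. $u\equiv_m^X v$ iff $u\equiv_{m,n}^X v$ for all $n\in\mathbb{N}$. *)

theory Defs
  imports Main
begin

text \<open>
  A generalized word is a labelled linear order; its domain is the field of the (reflexive) order
  relation. Words are meant up to isomorphism, so the type of positions is immaterial.
\<close>

datatype ('p, 'a) gword = GWord (le: "'p rel") (lab: "'p \<Rightarrow> 'a")

abbreviation wdom :: "('p, 'a) gword \<Rightarrow> 'p set" where
  "wdom w \<equiv> Field (le w)"

definition alph :: "('p, 'a) gword \<Rightarrow> 'a set" where
  "alph w = lab w ` wdom w"

definition word_iso :: "('p, 'a) gword \<Rightarrow> ('q, 'a) gword \<Rightarrow> bool" where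
  "word_iso u v \<longleftrightarrow> (\<exists>f. bij_betw f (wdom u) (wdom v) \<and>
     (\<forall>p\<in>wdom u. \<forall>q\<in>wdom u. (p, q) \<in> le u \<longleftrightarrow> (f p, f q) \<in> le v) \<and>
     (\<forall>p\<in>wdom u. lab v (f p) = lab u p))"


subsection \<open>Order types\<close>

definition fin_order :: "nat \<Rightarrow> nat rel" where
  "fin_order n = {(i, j). i \<le> j \<and> j < n}"

text \<open>The order \<open>1, 2, 3, \<dots> \<dots>, -3, -2, -1\<close> on the nonzero integers.\<close>

definition omega_omega_star :: "int rel" where
  "omega_omega_star = {(i, j). (0 < i \<and> i \<le> j) \<or> (0 < i \<and> j < 0) \<or> (i \<le> j \<and> j < 0)}"


subsection \<open>Finite words\<close>

definition word_of_list :: "'a list \<Rightarrow> (nat, 'a) gword" where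
  "word_of_list xs = GWord (fin_order (length xs)) (nth xs)"

text \<open>
  The list that represents a generalized word with finite domain; it is unique by
  \<open>list_of_word_eqI\<close> below.
\<close>

definition list_of_word :: "('p, 'a) gword \<Rightarrow> 'a list" where
  "list_of_word w = (THE xs. word_iso (word_of_list xs) w)"


subsection \<open>Concatenation and powers\<close>

text \<open>
  Iterating the disjoint sum and the product with an order on \<open>'i\<close> changes the type of positions.
  The following type is closed under both operations: \<open>InL\<close> and \<open>InR\<close> are the injections into the
  sum, and \<open>At p i\<close> is the pair of a position \<open>p\<close> and an index \<open>i\<close>.
\<close>

datatype 'i pos = Here | InL "'i pos" | InR "'i pos" | At "'i pos" 'i

definition wconcat :: "('i pos, 'a) gword \<Rightarrow> ('i pos, 'a) gword \<Rightarrow> ('i pos, 'a) gword" where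
  "wconcat u v = GWord
     ({(InL p, InL q) | p q. (p, q) \<in> le u} \<union>
      {(InR p, InR q) | p q. (p, q) \<in> le v} \<union>
      {(InL p, InR q) | p q. p \<in> wdom u \<and> q \<in> wdom v})
     (\<lambda>x. case x of InL p \<Rightarrow> lab u p | InR p \<Rightarrow> lab v p | _ \<Rightarrow> undefined)"

definition wpower :: "('i pos, 'a) gword \<Rightarrow> 'i rel \<Rightarrow> ('i pos, 'a) gword" where
  "wpower w r = GWord
     {(At p i, At q j) | p i q j. p \<in> wdom w \<and> q \<in> wdom w \<and> (i, j) \<in> r \<and>
        (i = j \<longrightarrow> (p, q) \<in> le w)}
     (\<lambda>x. case x of At p i \<Rightarrow> lab w p | _ \<Rightarrow> undefined)"


subsection \<open>\<open>\<pi>\<close>-terms\<close>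

text \<open>A term \<open>\<alpha>\<close> is a \<open>\<pi>\<close>-term over \<open>\<Sigma>\<close> iff \<open>set_pterm \<alpha> \<subseteq> \<Sigma>\<close>.\<close>

datatype 'a pterm = Eps | Letter 'a | Cat "'a pterm" "'a pterm" | Pi "'a pterm"

primrec interp :: "'i rel \<Rightarrow> 'a pterm \<Rightarrow> ('i pos, 'a) gword" where
  "interp \<mu> Eps = GWord {} (\<lambda>_. undefined)"
| "interp \<mu> (Letter a) = GWord {(Here, Here)} (\<lambda>_. a)"
| "interp \<mu> (Cat \<alpha> \<beta>) = wconcat (interp \<mu> \<alpha>) (interp \<mu> \<beta>)"
| "interp \<mu> (Pi \<alpha>) = wpower (interp \<mu> \<alpha>) \<mu>"


subsection \<open>Factors\<close>

text \<open>
  In an accessible word, in particular in a finite one and in every \<open>interp omega_omega_star \<alpha>\<close>, the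
  first and the last \<open>a\<close>-position exist for each \<open>a \<in> alph w\<close>, and factors are again accessible. The
  relations below are meaningful on such words only.
\<close>

definition first_pos :: "('p, 'a) gword \<Rightarrow> 'a \<Rightarrow> 'p" where
  "first_pos w a = (THE p. p \<in> wdom w \<and> lab w p = a \<and>
     (\<forall>q\<in>wdom w. lab w q = a \<longrightarrow> (p, q) \<in> le w))"

definition last_pos :: "('p, 'a) gword \<Rightarrow> 'a \<Rightarrow> 'p" where
  "last_pos w a = (THE p. p \<in> wdom w \<and> lab w p = a \<and>
     (\<forall>q\<in>wdom w. lab w q = a \<longrightarrow> (q, p) \<in> le w))"

definition left_of :: "('p, 'a) gword \<Rightarrow> 'p \<Rightarrow> ('p, 'a) gword" where
  "left_of w p = GWord (Restr (le w) (underS (le w) p)) (lab w)"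

definition right_of :: "('p, 'a) gword \<Rightarrow> 'p \<Rightarrow> ('p, 'a) gword" where
  "right_of w p = GWord (Restr (le w) (aboveS (le w) p)) (lab w)"

abbreviation XL :: "'a \<Rightarrow> ('p, 'a) gword \<Rightarrow> ('p, 'a) gword" where
  "XL a w \<equiv> left_of w (first_pos w a)"

abbreviation XR :: "'a \<Rightarrow> ('p, 'a) gword \<Rightarrow> ('p, 'a) gword" where
  "XR a w \<equiv> right_of w (first_pos w a)"

abbreviation YL :: "'a \<Rightarrow> ('p, 'a) gword \<Rightarrow> ('p, 'a) gword" where
  "YL a w \<equiv> left_of w (last_pos w a)"

abbreviation YR :: "'a \<Rightarrow> ('p, 'a) gword \<Rightarrow> ('p, 'a) gword" where
  "YR a w \<equiv> right_of w (last_pos w a)"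


subsection \<open>The relations on accessible words\<close>

fun eqX :: "nat \<Rightarrow> nat \<Rightarrow> ('p, 'a) gword \<Rightarrow> ('q, 'a) gword \<Rightarrow> bool"
  and eqY :: "nat \<Rightarrow> nat \<Rightarrow> ('p, 'a) gword \<Rightarrow> ('q, 'a) gword \<Rightarrow> bool" where
  "eqX 0 n u v = True"
| "eqX (Suc m) 0 u v = True"
| "eqX (Suc m) (Suc n) u v \<longleftrightarrow> alph u = alph v \<and> eqY m n u v \<and>
     (\<forall>a\<in>alph u. eqY m n (XL a u) (XL a v) \<and> eqX (Suc m) n (XR a u) (XR a v))"
| "eqY 0 n u v = True"
| "eqY (Suc m) 0 u v = True"
| "eqY (Suc m) (Suc n) u v \<longleftrightarrow> alph u = alph v \<and> eqX m n u v \<and>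
     (\<forall>a\<in>alph u. eqY (Suc m) n (YL a u) (YL a v) \<and> eqX m n (YR a u) (YR a v))"

definition eqX_lim :: "nat \<Rightarrow> ('p, 'a) gword \<Rightarrow> ('q, 'a) gword \<Rightarrow> bool" where
  "eqX_lim m u v \<longleftrightarrow> (\<forall>n\<ge>1. eqX m n u v)"


subsection \<open>The exponent of a finite monoid\<close>

definition monoid_fact :: "'m::{finite, monoid_mult} itself \<Rightarrow> nat" where
  "monoid_fact _ = (LEAST n. 1 \<le> n \<and> (\<forall>x::'m. x ^ n * x ^ n = x ^ n))"


subsection \<open>Well-definedness\<close>

lemma Field_fin_order [simp]: "Field (fin_order n) = {..<n}"
  by (auto simp: fin_order_def Field_def)

lemma le_word_of_list [simp]: "le (word_of_list xs) = fin_order (length xs)"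
  and lab_word_of_list [simp]: "lab (word_of_list xs) = nth xs"
  by (simp_all add: word_of_list_def)

lemma word_iso_lists_eq:
  assumes "word_iso (word_of_list xs) w" "word_iso (word_of_list ys) w"
  shows "xs = ys"
proof -
  let ?n = "length xs" and ?k = "length ys"
  obtain f where f: "bij_betw f {..<?n} (wdom w)"
    "\<And>p q. p < ?n \<Longrightarrow> q < ?n \<Longrightarrow> (p, q) \<in> fin_order ?n \<longleftrightarrow> (f p, f q) \<in> le w"
    "\<And>p. p < ?n \<Longrightarrow> lab w (f p) = xs ! p"
    using assms(1) by (auto simp: word_iso_def)
  obtain g where g: "bij_betw g {..<?k} (wdom w)"
    "\<And>p q. p < ?k \<Longrightarrow> q < ?k \<Longrightarrow> (p, q) \<in> fin_order ?k \<longleftrightarrow> (g p, g q) \<in> le w"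
    "\<And>p. p < ?k \<Longrightarrow> lab w (g p) = ys ! p"
    using assms(2) by (auto simp: word_iso_def)
  have nk: "?n = ?k"
    using bij_betw_same_card[OF f(1)] bij_betw_same_card[OF g(1)] by simp
  have "f p = g p" if "p < ?n" for p
    using that
  proof (induction p rule: less_induct)
    case (less p)
    have "g p \<in> f ` {..<?n}" "f p \<in> g ` {..<?n}"
      using f(1) g(1) less.prems nk by (auto simp: bij_betw_def)
    then obtain i j where i: "i < ?n" "g p = f i" and j: "j < ?n" "f p = g j" by auto
    have inj: "inj_on f {..<?n}" "inj_on g {..<?n}"
      using f(1) g(1) nk by (auto simp: bij_betw_def)
    have "p \<le> i"
    proof (rule ccontr)
      assume "\<not> p \<le> i"
      then have "g i = g p" using less.IH[of i] i by simp
      then show False using inj_onD[OF inj(2), of i p] i less.prems nk \<open>\<not> p \<le> i\<close> by simp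
    qed
    have "p \<le> j"
    proof (rule ccontr)
      assume "\<not> p \<le> j"
      then have "f j = f p" using less.IH[of j] j nk by simp
      then show False using inj_onD[OF inj(1), of j p] j less.prems nk \<open>\<not> p \<le> j\<close> by simp
    qed
    have "(f p, f i) \<in> le w"
      using f(2)[of p i] less.prems i \<open>p \<le> i\<close> by (simp add: fin_order_def)
    then have "(g j, g p) \<in> le w" using i j by simp
    then have "j \<le> p"
      using g(2)[of j p] nk j less.prems by (simp add: fin_order_def)
    with \<open>p \<le> j\<close> j show ?case by simp
  qed
  then show ?thesis
    using nk f(3) g(3) by (intro nth_equalityI) (simp, metis)
qed

lemma list_of_word_eqI: "word_iso (word_of_list xs) w \<Longrightarrow> list_of_word w = xs"
  unfolding list_of_word_def using word_iso_lists_eq by blast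

lemma ex_list_word_iso:
  assumes lin: "Linear_order (le w)" and fin: "finite (wdom w)"
  shows "\<exists>xs. word_iso (word_of_list xs) w"
proof -
  let ?r = "le w" and ?D = "wdom w"
  define c where "c p = card (underS ?r p)" for p
  have sub: "underS ?r p \<subseteq> ?D" for p
    by (auto simp: underS_def Field_def)
  have refl: "(p, p) \<in> ?r" if "p \<in> ?D" for p
    using lin that by (auto simp: order_on_defs refl_on_def)
  have tr: "trans ?r" and anti: "antisym ?r" and tot: "total_on ?D ?r"
    using lin by (auto simp: order_on_defs)
  have less: "c p < c q" if "(p, q) \<in> ?r" "p \<noteq> q" for p q
  proof -
    have "p \<in> underS ?r q" "p \<notin> underS ?r p"
      using that by (auto simp: underS_def)
    moreover have "underS ?r p \<subseteq> underS ?r q"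
      using that transD[OF tr] antisymD[OF anti] by (fastforce simp: underS_def)
    ultimately show ?thesis
      unfolding c_def using fin sub by (intro psubset_card_mono) (auto intro: finite_subset)
  qed
  have le_iff: "(p, q) \<in> ?r \<longleftrightarrow> c p \<le> c q" if "p \<in> ?D" "q \<in> ?D" for p q
  proof (cases "p = q")
    case True
    then show ?thesis using refl that by simp
  next
    case False
    then have "(p, q) \<in> ?r \<or> (q, p) \<in> ?r"
      using tot that by (auto simp: total_on_def)
    moreover have "\<not> ((p, q) \<in> ?r \<and> (q, p) \<in> ?r)"
      using False antisymD[OF anti] by blast
    ultimately show ?thesis using less[of p q] less[of q p] False by auto
  qed
  have inj: "inj_on c ?D"
    using le_iff antisymD[OF anti] by (auto intro!: inj_onI)
  have "c ` ?D \<subseteq> {..<card ?D}"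
  proof
    fix k assume "k \<in> c ` ?D"
    then obtain p where "p \<in> ?D" "k = c p" by auto
    moreover have "underS ?r p \<subset> ?D"
      using sub \<open>p \<in> ?D\<close> by (auto simp: underS_def)
    ultimately show "k \<in> {..<card ?D}"
      using psubset_card_mono[OF fin] by (simp add: c_def)
  qed
  then have "c ` ?D = {..<card ?D}"
    by (intro card_subset_eq) (simp_all add: card_image[OF inj])
  with inj have bij: "bij_betw c ?D {..<card ?D}" by (simp add: bij_betw_def)
  define f where "f = inv_into ?D c"
  have bijf: "bij_betw f {..<card ?D} ?D"
    using bij_betw_inv_into[OF bij] by (simp add: f_def)
  have cf: "c (f i) = i" "f i \<in> ?D" if "i < card ?D" for i
    using bij_betw_inv_into_right[OF bij, of i] bij_betwE[OF bijf] that by (auto simp: f_def)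
  have "word_iso (word_of_list (map (\<lambda>i. lab w (f i)) [0..<card ?D])) w"
    unfolding word_iso_def
  proof (intro exI[of _ f] conjI ballI)
    fix p q
    assume "p \<in> wdom (word_of_list (map (\<lambda>i. lab w (f i)) [0..<card ?D]))"
      "q \<in> wdom (word_of_list (map (\<lambda>i. lab w (f i)) [0..<card ?D]))"
    then have "p < card ?D" "q < card ?D" by simp_all
    then show "(p, q) \<in> le (word_of_list (map (\<lambda>i. lab w (f i)) [0..<card ?D])) \<longleftrightarrow>
        (f p, f q) \<in> le w"
      using cf by (simp add: le_iff) (simp add: fin_order_def)
  qed (use bijf in simp_all)
  then show ?thesis by blast
qed

lemma Linear_orderI:
  assumes "\<And>p. p \<in> Field r \<Longrightarrow> (p, p) \<in> r"
    and "\<And>p q s. (p, q) \<in> r \<Longrightarrow> (q, s) \<in> r \<Longrightarrow> (p, s) \<in> r"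
    and "\<And>p q. (p, q) \<in> r \<Longrightarrow> (q, p) \<in> r \<Longrightarrow> p = q"
    and "\<And>p q. p \<in> Field r \<Longrightarrow> q \<in> Field r \<Longrightarrow> (p, q) \<in> r \<or> (q, p) \<in> r"
  shows "Linear_order r"
  unfolding order_on_defs refl_on_def trans_def antisym_def total_on_def
  using assms by (auto simp: Field_def)

lemma Linear_orderD:
  assumes "Linear_order r"
  shows "p \<in> Field r \<Longrightarrow> (p, p) \<in> r"
    and "(p, q) \<in> r \<Longrightarrow> (q, s) \<in> r \<Longrightarrow> (p, s) \<in> r"
    and "(p, q) \<in> r \<Longrightarrow> (q, p) \<in> r \<Longrightarrow> p = q"
    and "p \<in> Field r \<Longrightarrow> q \<in> Field r \<Longrightarrow> (p, q) \<in> r \<or> (q, p) \<in> r"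
proof -
  have *: "refl_on (Field r) r" "trans r" "antisym r" "total_on (Field r) r"
    using assms by (simp_all add: order_on_defs)
  show refl: "(p, p) \<in> r" if "p \<in> Field r" for p
    using *(1) that by (rule refl_onD)
  show "(p, q) \<in> r \<Longrightarrow> (q, s) \<in> r \<Longrightarrow> (p, s) \<in> r"
    using *(2) by (rule transD)
  show "(p, q) \<in> r \<Longrightarrow> (q, p) \<in> r \<Longrightarrow> p = q"
    using *(3) by (rule antisymD)
  show "p \<in> Field r \<Longrightarrow> q \<in> Field r \<Longrightarrow> (p, q) \<in> r \<or> (q, p) \<in> r"
    using *(4) refl by (cases "p = q") (auto simp: total_on_def)
qed

lemma Linear_order_fin_order: "Linear_order (fin_order n)"
  by (rule Linear_orderI) (auto simp: fin_order_def Field_def)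

lemma Field_omega_omega_star: "Field omega_omega_star = - {0}"
proof -
  have "(i, i) \<in> omega_omega_star" if "i \<noteq> 0" for i
    using that by (auto simp: omega_omega_star_def)
  then show ?thesis
    by (auto intro: FieldI1) (auto simp: omega_omega_star_def Field_def)
qed

lemma Linear_order_omega_omega_star: "Linear_order omega_omega_star"
proof (rule Linear_orderI, unfold Field_omega_omega_star)
qed (auto simp: omega_omega_star_def)

lemma wdom_wconcat: "wdom (wconcat u v) = InL ` wdom u \<union> InR ` wdom v"
proof
  show "wdom (wconcat u v) \<subseteq> InL ` wdom u \<union> InR ` wdom v"
    by (auto simp: wconcat_def Field_def)
  have "(InL p, InL q) \<in> le (wconcat u v)" if "(p, q) \<in> le u" for p q
    using that by (simp add: wconcat_def)
  moreover have "(InR p, InR q) \<in> le (wconcat u v)" if "(p, q) \<in> le v" for p q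
    using that by (simp add: wconcat_def)
  ultimately show "InL ` wdom u \<union> InR ` wdom v \<subseteq> wdom (wconcat u v)"
    by (force simp: Field_def)
qed

lemma wdom_wpower:
  assumes "Linear_order (le w)" "Linear_order r"
  shows "wdom (wpower w r) = (\<lambda>(p, i). At p i) ` (wdom w \<times> Field r)"
proof
  show "wdom (wpower w r) \<subseteq> (\<lambda>(p, i). At p i) ` (wdom w \<times> Field r)"
    by (auto simp: wpower_def Field_def)
  have "(At p i, At p i) \<in> le (wpower w r)" if "p \<in> wdom w" "i \<in> Field r" for p i
    using that assms[THEN Linear_orderD(1)] by (auto simp: wpower_def)
  then show "(\<lambda>(p, i). At p i) ` (wdom w \<times> Field r) \<subseteq> wdom (wpower w r)"
    by (auto intro: FieldI1)
qed

lemma Linear_order_wconcat: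
  assumes "Linear_order (le u)" "Linear_order (le v)"
  shows "Linear_order (le (wconcat u v))"
proof (rule Linear_orderI, unfold wdom_wconcat)
  note u = Linear_orderD[OF assms(1)] and v = Linear_orderD[OF assms(2)]
  have le: "(InL p, InL q) \<in> le (wconcat u v) \<longleftrightarrow> (p, q) \<in> le u"
    "(InR p, InR q) \<in> le (wconcat u v) \<longleftrightarrow> (p, q) \<in> le v"
    "(InL p, InR q) \<in> le (wconcat u v) \<longleftrightarrow> p \<in> wdom u \<and> q \<in> wdom v"
    "(InR p, InL q) \<notin> le (wconcat u v)" for p q
    by (simp_all add: wconcat_def)
  have dom: "x \<in> InL ` wdom u \<union> InR ` wdom v" "y \<in> InL ` wdom u \<union> InR ` wdom v"
    if "(x, y) \<in> le (wconcat u v)" for x y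
    using that FieldI1[of x y] FieldI2[of x y] unfolding wdom_wconcat[symmetric] by blast+
  show "(x, x) \<in> le (wconcat u v)" if "x \<in> InL ` wdom u \<union> InR ` wdom v" for x
    using that u(1) v(1) by (auto simp: le)
  show "(x, z) \<in> le (wconcat u v)"
    if xy: "(x, y) \<in> le (wconcat u v)" and yz: "(y, z) \<in> le (wconcat u v)" for x y z
    using xy yz dom[OF xy] dom(2)[OF yz] by (auto simp: le intro: u(2) v(2))
  show "x = y" if xy: "(x, y) \<in> le (wconcat u v)" and yx: "(y, x) \<in> le (wconcat u v)" for x y
    using xy yx dom[OF xy] by (auto simp: le dest: u(3) v(3))
  show "(x, y) \<in> le (wconcat u v) \<or> (y, x) \<in> le (wconcat u v)"
    if "x \<in> InL ` wdom u \<union> InR ` wdom v" "y \<in> InL ` wdom u \<union> InR ` wdom v" for x y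
    using that by (auto simp: le dest: u(4) v(4))
qed

lemma Linear_order_wpower:
  assumes "Linear_order (le w)" "Linear_order r"
  shows "Linear_order (le (wpower w r))"
proof (rule Linear_orderI, unfold wdom_wpower[OF assms])
  note w = Linear_orderD[OF assms(1)] and r = Linear_orderD[OF assms(2)]
  have le: "(At p i, At q j) \<in> le (wpower w r) \<longleftrightarrow>
      p \<in> wdom w \<and> q \<in> wdom w \<and> (i, j) \<in> r \<and> (i = j \<longrightarrow> (p, q) \<in> le w)" for p i q j
    by (simp add: wpower_def)
  have At: "\<exists>p i q j. x = At p i \<and> y = At q j" if "(x, y) \<in> le (wpower w r)" for x y
    using that by (auto simp: wpower_def)
  show "(x, x) \<in> le (wpower w r)" if "x \<in> (\<lambda>(p, i). At p i) ` (wdom w \<times> Field r)" for x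
    using that w(1) r(1) by (auto simp: le)
  show "(x, z) \<in> le (wpower w r)"
    if xy: "(x, y) \<in> le (wpower w r)" and yz: "(y, z) \<in> le (wpower w r)" for x y z
  proof -
    obtain p i q j s k where eq: "x = At p i" "y = At q j" "z = At s k"
      using At[OF xy] At[OF yz] by blast
    have "(p, s) \<in> le w" if "i = k"
    proof -
      have "i = j" using xy yz that r(3)[of i j] by (simp add: eq le)
      then show ?thesis using xy yz that w(2)[of p q s] by (simp add: eq le)
    qed
    then show ?thesis using xy yz r(2)[of i j k] by (simp add: eq le)
  qed
  show "x = y" if xy: "(x, y) \<in> le (wpower w r)" and yx: "(y, x) \<in> le (wpower w r)" for x y
  proof -
    obtain p i q j where eq: "x = At p i" "y = At q j"
      using At[OF xy] by blast
    have "i = j" using xy yx r(3)[of i j] by (simp add: eq le)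
    then show ?thesis using xy yx w(3)[of p q] by (simp add: eq le)
  qed
  show "(x, y) \<in> le (wpower w r) \<or> (y, x) \<in> le (wpower w r)"
    if x: "x \<in> (\<lambda>(p, i). At p i) ` (wdom w \<times> Field r)"
      and y: "y \<in> (\<lambda>(p, i). At p i) ` (wdom w \<times> Field r)" for x y
  proof -
    obtain p i q j where "x = At p i" "y = At q j" "p \<in> wdom w" "q \<in> wdom w"
      "i \<in> Field r" "j \<in> Field r"
      using x y by auto
    then show ?thesis using r(4)[of i j] w(4)[of p q] by (cases "i = j") (auto simp: le)
  qed
qed

lemma Linear_order_interp: "Linear_order \<mu> \<Longrightarrow> Linear_order (le (interp \<mu> \<alpha>))"
proof (induction \<alpha>)
  case Eps
  show ?case by (rule Linear_orderI) auto
next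
  case (Letter a)
  show ?case by (rule Linear_orderI) (auto simp: Field_def)
qed (simp_all add: Linear_order_wconcat Linear_order_wpower)

lemma finite_wdom_interp:
  assumes "Linear_order \<mu>" "finite (Field \<mu>)"
  shows "finite (wdom (interp \<mu> \<alpha>))"
  using assms
  by (induction \<alpha>) (simp_all add: wdom_wconcat wdom_wpower Linear_order_interp)

lemma word_iso_list_of_word_interp:
  "word_iso (word_of_list (list_of_word (interp (fin_order n) \<alpha>))) (interp (fin_order n) \<alpha>)"
  using ex_list_word_iso[of "interp (fin_order n) \<alpha>"] list_of_word_eqI
    Linear_order_interp Linear_order_fin_order finite_wdom_interp[of "fin_order n" \<alpha>]
  by (metis Field_fin_order finite_lessThan)

end

theory Submission
  imports Defs "HOL-Library.Sublist"
begin

text \<open>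
  The factors of \<open>[\<gamma>]\<^bsub>\<omega>+\<omega>*\<^esub>\<close> at first and last letters are again given by \<open>\<pi>\<close>-terms, since
  \<open>w\<^sup>\<pi>\<close>, \<open>w w\<^sup>\<pi>\<close> and \<open>w\<^sup>\<pi> w\<close> are isomorphic. So the relations can be studied on terms.

  Level 1 compares scattered subwords. Here both sequences may be treated separately: along a
  subsequence, the sets of subwords of finite words with a fixed value converge to that of a term.

  For level \<open>m \<ge> 2\<close> cut off arches, that is, shortest prefixes containing the full alphabet. Words related by
  \<open>\<equiv>\<^sup>X\<close> have arches ending in the same letter, and the arch without this letter uses a smaller
  alphabet. So the pair of values of \<open>u, v\<close> either has a smaller alphabet, or is a product of a pair
  already realised by terms with a full alphabet and another such pair. If this never ends, two prefix
  products \<open>g\<close> agree, so \<open>g = g s\<close>, and the terms \<open>\<gamma> \<delta>\<^sup>\<pi> \<zeta>\<close> with values \<open>g, s\<close> and that of the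
  remainder do the job. Nothing right of \<open>\<delta>\<^sup>\<pi>\<close> is seen by \<open>\<equiv>\<^sup>X\<close> except up to \<open>\<equiv>\<^sup>Y\<close> one level below.
  As \<open>g s = g\<close> gives \<open>g s\<^sup>k = g\<close> for all \<open>k\<close>, the choice of the exponent of \<open>M\<close> is immaterial.
\<close>

subsection \<open>Isomorphisms of words\<close>

lemma word_isoI:
  assumes "bij_betw f (wdom u) (wdom v)"
    and "\<And>p q. p \<in> wdom u \<Longrightarrow> q \<in> wdom u \<Longrightarrow> (p, q) \<in> le u \<longleftrightarrow> (f p, f q) \<in> le v"
    and "\<And>p. p \<in> wdom u \<Longrightarrow> lab v (f p) = lab u p"
  shows "word_iso u v"
  using assms unfolding word_iso_def by blast

lemma word_iso_refl: "word_iso u u"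
  by (rule word_isoI[of id]) auto

lemma word_iso_trans:
  assumes "word_iso u v" "word_iso v w"
  shows "word_iso u w"
proof -
  obtain f where f: "bij_betw f (wdom u) (wdom v)"
    "\<And>p q. p \<in> wdom u \<Longrightarrow> q \<in> wdom u \<Longrightarrow> (p, q) \<in> le u \<longleftrightarrow> (f p, f q) \<in> le v"
    "\<And>p. p \<in> wdom u \<Longrightarrow> lab v (f p) = lab u p"
    using assms(1) unfolding word_iso_def by blast
  obtain g where g: "bij_betw g (wdom v) (wdom w)"
    "\<And>p q. p \<in> wdom v \<Longrightarrow> q \<in> wdom v \<Longrightarrow> (p, q) \<in> le v \<longleftrightarrow> (g p, g q) \<in> le w"
    "\<And>p. p \<in> wdom v \<Longrightarrow> lab w (g p) = lab v p"
    using assms(2) unfolding word_iso_def by blast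
  have "f p \<in> wdom v" if "p \<in> wdom u" for p
    using bij_betwE[OF f(1)] that by blast
  then show ?thesis
    using bij_betw_trans[OF f(1) g(1)] by (intro word_isoI[of "g \<circ> f"]) (simp_all add: f g)
qed

lemma word_iso_sym:
  assumes "word_iso u v"
  shows "word_iso v u"
proof -
  obtain f where f: "bij_betw f (wdom u) (wdom v)"
    "\<And>p q. p \<in> wdom u \<Longrightarrow> q \<in> wdom u \<Longrightarrow> (p, q) \<in> le u \<longleftrightarrow> (f p, f q) \<in> le v"
    "\<And>p. p \<in> wdom u \<Longrightarrow> lab v (f p) = lab u p"
    using assms unfolding word_iso_def by blast
  let ?g = "inv_into (wdom u) f"
  have g: "bij_betw ?g (wdom v) (wdom u)"
    by (rule bij_betw_inv_into[OF f(1)])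
  have fg: "?g p \<in> wdom u" "f (?g p) = p" if "p \<in> wdom v" for p
    using that bij_betwE[OF g] bij_betw_inv_into_right[OF f(1)] by auto
  show ?thesis
    using g fg f(2,3)[OF fg(1)] f(2)[OF fg(1) fg(1)] by (intro word_isoI[of ?g]) (simp, simp, metis)
qed

lemma alph_word_iso:
  assumes "word_iso u v"
  shows "alph u = alph v"
proof -
  obtain f where "bij_betw f (wdom u) (wdom v)" "\<forall>p\<in>wdom u. lab v (f p) = lab u p"
    using assms unfolding word_iso_def by blast
  then have "lab v ` f ` wdom u = lab u ` wdom u" "f ` wdom u = wdom v"
    unfolding image_image by (auto simp only: bij_betw_def intro!: image_cong)
  then show ?thesis by (simp add: alph_def)
qed

lemma Linear_order_word_iso:
  assumes "word_iso u v" "Linear_order (le u)"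
  shows "Linear_order (le v)"
proof -
  obtain f where f: "bij_betw f (wdom u) (wdom v)"
    "\<And>p q. p \<in> wdom u \<Longrightarrow> q \<in> wdom u \<Longrightarrow> (p, q) \<in> le u \<longleftrightarrow> (f p, f q) \<in> le v"
    using assms(1) unfolding word_iso_def by blast
  note u = Linear_orderD[OF assms(2)]
  have dom: "\<exists>p'\<in>wdom u. p = f p'" if "p \<in> wdom v" for p
    using f(1) that by (auto simp: bij_betw_def)
  have dom2: "\<exists>p'\<in>wdom u. \<exists>q'\<in>wdom u. p = f p' \<and> q = f q' \<and> (p', q') \<in> le u"
    if "(p, q) \<in> le v" for p q
    using that dom[of p] dom[of q] f(2) FieldI1[OF that] FieldI2[OF that] by fastforce
  have inj: "p = q" if "f p = f q" "p \<in> wdom u" "q \<in> wdom u" for p q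
    using that f(1) by (auto simp: bij_betw_def inj_on_def)
  show ?thesis
  proof (rule Linear_orderI)
    show "(p, p) \<in> le v" if "p \<in> wdom v" for p
      using dom[OF that] f(2) u(1) by auto
    show "(p, s) \<in> le v" if pq: "(p, q) \<in> le v" "(q, s) \<in> le v" for p q s
    proof -
      obtain p' q' where 1: "p'\<in>wdom u" "q'\<in>wdom u" "p = f p'" "q = f q'" "(p', q') \<in> le u"
        using dom2[OF pq(1)] by blast
      obtain q'' s' where 2: "q''\<in>wdom u" "s'\<in>wdom u" "q = f q''" "s = f s'" "(q'', s') \<in> le u"
        using dom2[OF pq(2)] by blast
      have "q' = q''" using inj 1 2 by metis
      then show ?thesis using 1 2 u(2)[of p' q' s'] f(2)[of p' s'] by simp
    qed
    show "p = q" if "(p, q) \<in> le v" "(q, p) \<in> le v" for p q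
      using dom2[OF that(1)] that(2) f(2) u(3) by fastforce
    show "(p, q) \<in> le v \<or> (q, p) \<in> le v" if "p \<in> wdom v" "q \<in> wdom v" for p q
      using dom[OF that(1)] dom[OF that(2)] f(2) u(4) by fastforce
  qed
qed

section \<open>Concatenations and powers up to isomorphism\<close>

lemma le_wconcat:
  "(InL p, InL q) \<in> le (wconcat u v) \<longleftrightarrow> (p, q) \<in> le u"
  "(InR p, InR q) \<in> le (wconcat u v) \<longleftrightarrow> (p, q) \<in> le v"
  "(InL p, InR q) \<in> le (wconcat u v) \<longleftrightarrow> p \<in> wdom u \<and> q \<in> wdom v"
  "(InR p, InL q) \<notin> le (wconcat u v)"
  by (simp_all add: wconcat_def)

lemma lab_wconcat [simp]:
  "lab (wconcat u v) (InL p) = lab u p" "lab (wconcat u v) (InR p) = lab v p"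
  by (simp_all add: wconcat_def)

lemma le_wpower:
  "(At p i, At q j) \<in> le (wpower w r) \<longleftrightarrow>
    p \<in> wdom w \<and> q \<in> wdom w \<and> (i, j) \<in> r \<and> (i = j \<longrightarrow> (p, q) \<in> le w)"
  by (simp add: wpower_def)

lemma lab_wpower [simp]: "lab (wpower w r) (At p i) = lab w p"
  by (simp add: wpower_def)

lemma alph_wconcat: "alph (wconcat u v) = alph u \<union> alph v"
  by (auto simp: alph_def wdom_wconcat image_Un image_image)

lemma alph_wpower:
  assumes "Linear_order (le w)" "Linear_order r" "Field r \<noteq> {}"
  shows "alph (wpower w r) = alph w"
proof -
  have "alph (wpower w r) = (\<lambda>(p, i). lab w p) ` (wdom w \<times> Field r)"
    unfolding alph_def wdom_wpower[OF assms(1,2)] image_image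
    by (rule image_cong) auto
  also have "\<dots> = lab w ` fst ` (wdom w \<times> Field r)"
    unfolding image_image by (rule image_cong) auto
  finally show ?thesis
    using assms(3) by (simp add: alph_def)
qed

lemma word_iso_wconcat:
  assumes "word_iso u u'" "word_iso v v'"
  shows "word_iso (wconcat u v) (wconcat u' v')"
proof -
  obtain f where f: "bij_betw f (wdom u) (wdom u')"
    "\<And>p q. p \<in> wdom u \<Longrightarrow> q \<in> wdom u \<Longrightarrow> (p, q) \<in> le u \<longleftrightarrow> (f p, f q) \<in> le u'"
    "\<And>p. p \<in> wdom u \<Longrightarrow> lab u' (f p) = lab u p"
    using assms(1) unfolding word_iso_def by blast
  obtain g where g: "bij_betw g (wdom v) (wdom v')"
    "\<And>p q. p \<in> wdom v \<Longrightarrow> q \<in> wdom v \<Longrightarrow> (p, q) \<in> le v \<longleftrightarrow> (g p, g q) \<in> le v'"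
    "\<And>p. p \<in> wdom v \<Longrightarrow> lab v' (g p) = lab v p"
    using assms(2) unfolding word_iso_def by blast
  define h where "h x = (case x of InL p \<Rightarrow> InL (f p) | InR p \<Rightarrow> InR (g p) | _ \<Rightarrow> Here)" for x
  have h: "h (InL p) = InL (f p)" "h (InR p) = InR (g p)" for p
    by (simp_all add: h_def)
  have fF: "f p \<in> wdom u'" if "p \<in> wdom u" for p using bij_betwE[OF f(1)] that by blast
  have gF: "g p \<in> wdom v'" if "p \<in> wdom v" for p using bij_betwE[OF g(1)] that by blast
  have "bij_betw h (InL ` wdom u \<union> InR ` wdom v) (InL ` wdom u' \<union> InR ` wdom v')"
  proof (rule bij_betw_combine)
    show "bij_betw h (InL ` wdom u) (InL ` wdom u')"
      using f(1) unfolding bij_betw_def inj_on_def by (simp add: h image_image) blast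
    show "bij_betw h (InR ` wdom v) (InR ` wdom v')"
      using g(1) unfolding bij_betw_def inj_on_def by (simp add: h image_image) blast
  qed blast
  then have "bij_betw h (wdom (wconcat u v)) (wdom (wconcat u' v'))"
    by (simp only: wdom_wconcat)
  then show ?thesis
  proof (rule word_isoI)
    fix x y assume "x \<in> wdom (wconcat u v)" "y \<in> wdom (wconcat u v)"
    then show "(x, y) \<in> le (wconcat u v) \<longleftrightarrow> (h x, h y) \<in> le (wconcat u' v')"
      unfolding wdom_wconcat
      by (elim UnE imageE) (simp_all add: h le_wconcat f(2) g(2) fF gF)
  next
    fix x assume "x \<in> wdom (wconcat u v)"
    then show "lab (wconcat u' v') (h x) = lab (wconcat u v) x"
      unfolding wdom_wconcat by (elim UnE imageE) (simp_all add: h f(3) g(3))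
  qed
qed

lemma word_iso_wconcat_assoc:
  fixes u v w :: "('i pos, 'a) gword"
  shows "word_iso (wconcat (wconcat u v) w) (wconcat u (wconcat v w))"
proof -
  define h where "h x = (case x of InL (InL p) \<Rightarrow> InL p | InL (InR p) \<Rightarrow> InR (InL p)
    | InR p \<Rightarrow> InR (InR p) | _ \<Rightarrow> Here)" for x :: "'i pos"
  have h: "h (InL (InL p)) = InL p" "h (InL (InR p)) = InR (InL p)" "h (InR p) = InR (InR p)" for p
    by (simp_all add: h_def)
  show ?thesis
  proof (rule word_isoI[of h])
    show "bij_betw h (wdom (wconcat (wconcat u v) w)) (wdom (wconcat u (wconcat v w)))"
      unfolding bij_betw_def
    proof
      show "inj_on h (wdom (wconcat (wconcat u v) w))"
        unfolding inj_on_def wdom_wconcat by (auto simp: h)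
      show "h ` wdom (wconcat (wconcat u v) w) = wdom (wconcat u (wconcat v w))"
        by (simp add: wdom_wconcat image_Un image_image h Un_assoc)
    qed
  next
    fix x y assume "x \<in> wdom (wconcat (wconcat u v) w)" "y \<in> wdom (wconcat (wconcat u v) w)"
    then show "(x, y) \<in> le (wconcat (wconcat u v) w) \<longleftrightarrow> (h x, h y) \<in> le (wconcat u (wconcat v w))"
      unfolding wdom_wconcat
      by (elim UnE imageE) (simp_all add: h le_wconcat wdom_wconcat image_iff)
  next
    fix x assume "x \<in> wdom (wconcat (wconcat u v) w)"
    then show "lab (wconcat u (wconcat v w)) (h x) = lab (wconcat (wconcat u v) w) x"
      unfolding wdom_wconcat by (elim UnE imageE) (simp_all add: h)
  qed
qed

text \<open>The copy of \<open>w\<close> at the least index \<open>i\<close> is split off, and the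
  other copies are renumbered along the order isomorphism \<open>g\<close>. With
  \<open>r' = r\<close> this unrolls a power over \<open>omega_omega_star\<close>, with a shorter
  order \<open>r'\<close> a finite power.\<close>

lemma word_iso_wpower_first:
  assumes w: "Linear_order (le w)" and r: "Linear_order r" "Linear_order r'"
    and i: "i \<in> Field r" "\<And>j. j \<in> Field r \<Longrightarrow> (i, j) \<in> r"
    and g: "bij_betw g (Field r - {i}) (Field r')"
      "\<And>j k. j \<in> Field r - {i} \<Longrightarrow> k \<in> Field r - {i} \<Longrightarrow> (j, k) \<in> r \<longleftrightarrow> (g j, g k) \<in> r'"
  shows "word_iso (wpower w r) (wconcat w (wpower w r'))"
proof -
  define h where "h x = (case x of At p j \<Rightarrow> if j = i then InL p else InR (At p (g j)) | _ \<Rightarrow> Here)" for x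
  have h: "h (At p j) = (if j = i then InL p else InR (At p (g j)))" for p j
    by (simp add: h_def)
  have im: "g ` (Field r - {i}) = Field r'" and inj: "inj_on g (Field r - {i})"
    using g(1) by (auto simp: bij_betw_def)
  have gF: "g j \<in> Field r'" if "j \<in> Field r" "j \<noteq> i" for j
    using im that by blast
  have geq: "g j = g k \<longleftrightarrow> j = k" if "j \<in> Field r" "j \<noteq> i" "k \<in> Field r" "k \<noteq> i" for j k
    using inj that by (auto simp: inj_on_def)
  have nle: "(j, i) \<notin> r" if "j \<in> Field r" "j \<noteq> i" for j
    using i(2)[OF that(1)] Linear_orderD(3)[OF r(1)] that(2) by blast
  have dom: "wdom (wconcat w (wpower w r')) = InL ` wdom w \<union> (\<lambda>(p, j). InR (At p j)) ` (wdom w \<times> Field r')"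
    by (auto simp: wdom_wconcat wdom_wpower[OF w r(2)])
  have At_mem: "At p j \<in> wdom (wpower w r') \<longleftrightarrow> p \<in> wdom w \<and> j \<in> Field r'" for p j
    by (auto simp: wdom_wpower[OF w r(2)])
  have dom_eq: "h ` (\<lambda>(p, j). At p j) ` (wdom w \<times> Field r) =
      InL ` wdom w \<union> (\<lambda>(p, j). InR (At p j)) ` (wdom w \<times> Field r')"
  proof safe
    fix p assume "p \<in> wdom w"
    then show "InL p \<in> h ` (\<lambda>(p, j). At p j) ` (wdom w \<times> Field r)"
      using i(1) by (intro image_eqI[of _ _ "At p i"]) (auto simp: h)
  next
    fix p j assume p: "p \<in> wdom w" and "j \<in> Field r'"
    then obtain k where "k \<in> Field r" "k \<noteq> i" "j = g k" using im by blast
    then show "InR (At p j) \<in> h ` (\<lambda>(p, j). At p j) ` (wdom w \<times> Field r)"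
      using p by (intro image_eqI[of _ _ "At p k"]) (auto simp: h)
  qed (auto simp: h gF split: if_splits)
  show ?thesis
  proof (rule word_isoI[of h])
    show "bij_betw h (wdom (wpower w r)) (wdom (wconcat w (wpower w r')))"
      unfolding bij_betw_def dom wdom_wpower[OF w r(1)]
      using dom_eq by (auto simp: inj_on_def h geq split: if_splits)
    show "(p, q) \<in> le (wpower w r) \<longleftrightarrow> (h p, h q) \<in> le (wconcat w (wpower w r'))"
      if pq: "p \<in> wdom (wpower w r)" "q \<in> wdom (wpower w r)" for p q
    proof -
      obtain x j y k where eq: "p = At x j" "q = At y k"
        and mem: "x \<in> wdom w" "j \<in> Field r" "y \<in> wdom w" "k \<in> Field r"
        using pq by (auto simp: wdom_wpower[OF w r(1)])
      show ?thesis
        using mem i(2) nle g(2)[of j k] gF geq Linear_orderD(1)[OF r(1)]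
        by (cases "j = i"; cases "k = i") (auto simp: eq h le_wconcat le_wpower At_mem)
    qed
  qed (auto simp: wdom_wpower[OF w r(1)] h)
qed

text \<open>Mirror image of \<open>word_iso_wpower_first\<close>, with a greatest index.\<close>

lemma word_iso_wpower_last:
  assumes w: "Linear_order (le w)" and r: "Linear_order r" "Linear_order r'"
    and i: "i \<in> Field r" "\<And>j. j \<in> Field r \<Longrightarrow> (j, i) \<in> r"
    and g: "bij_betw g (Field r - {i}) (Field r')"
      "\<And>j k. j \<in> Field r - {i} \<Longrightarrow> k \<in> Field r - {i} \<Longrightarrow> (j, k) \<in> r \<longleftrightarrow> (g j, g k) \<in> r'"
  shows "word_iso (wpower w r) (wconcat (wpower w r') w)"
proof -
  define h where "h x = (case x of At p j \<Rightarrow> if j = i then InR p else InL (At p (g j)) | _ \<Rightarrow> Here)" for x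
  have h: "h (At p j) = (if j = i then InR p else InL (At p (g j)))" for p j
    by (simp add: h_def)
  have im: "g ` (Field r - {i}) = Field r'" and inj: "inj_on g (Field r - {i})"
    using g(1) by (auto simp: bij_betw_def)
  have gF: "g j \<in> Field r'" if "j \<in> Field r" "j \<noteq> i" for j
    using im that by blast
  have geq: "g j = g k \<longleftrightarrow> j = k" if "j \<in> Field r" "j \<noteq> i" "k \<in> Field r" "k \<noteq> i" for j k
    using inj that by (auto simp: inj_on_def)
  have nle: "(i, j) \<notin> r" if "j \<in> Field r" "j \<noteq> i" for j
    using i(2)[OF that(1)] Linear_orderD(3)[OF r(1)] that(2) by blast
  have dom: "wdom (wconcat (wpower w r') w) = InR ` wdom w \<union> (\<lambda>(p, j). InL (At p j)) ` (wdom w \<times> Field r')"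
    by (auto simp: wdom_wconcat wdom_wpower[OF w r(2)])
  have At_mem: "At p j \<in> wdom (wpower w r') \<longleftrightarrow> p \<in> wdom w \<and> j \<in> Field r'" for p j
    by (auto simp: wdom_wpower[OF w r(2)])
  have dom_eq: "h ` (\<lambda>(p, j). At p j) ` (wdom w \<times> Field r) =
      InR ` wdom w \<union> (\<lambda>(p, j). InL (At p j)) ` (wdom w \<times> Field r')"
  proof safe
    fix p assume "p \<in> wdom w"
    then show "InR p \<in> h ` (\<lambda>(p, j). At p j) ` (wdom w \<times> Field r)"
      using i(1) by (intro image_eqI[of _ _ "At p i"]) (auto simp: h)
  next
    fix p j assume p: "p \<in> wdom w" and "j \<in> Field r'"
    then obtain k where "k \<in> Field r" "k \<noteq> i" "j = g k" using im by blast
    then show "InL (At p j) \<in> h ` (\<lambda>(p, j). At p j) ` (wdom w \<times> Field r)"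
      using p by (intro image_eqI[of _ _ "At p k"]) (auto simp: h)
  qed (auto simp: h gF split: if_splits)
  show ?thesis
  proof (rule word_isoI[of h])
    show "bij_betw h (wdom (wpower w r)) (wdom (wconcat (wpower w r') w))"
      unfolding bij_betw_def dom wdom_wpower[OF w r(1)]
      using dom_eq by (auto simp: inj_on_def h geq split: if_splits)
    show "(p, q) \<in> le (wpower w r) \<longleftrightarrow> (h p, h q) \<in> le (wconcat (wpower w r') w)"
      if pq: "p \<in> wdom (wpower w r)" "q \<in> wdom (wpower w r)" for p q
    proof -
      obtain x j y k where eq: "p = At x j" "q = At y k"
        and mem: "x \<in> wdom w" "j \<in> Field r" "y \<in> wdom w" "k \<in> Field r"
        using pq by (auto simp: wdom_wpower[OF w r(1)])
      show ?thesis
        using mem i(2) nle g(2)[of j k] gF geq Linear_orderD(1)[OF r(1)]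
        by (cases "j = i"; cases "k = i") (auto simp: eq h le_wconcat le_wpower At_mem)
    qed
  qed (auto simp: wdom_wpower[OF w r(1)] h)
qed

text \<open>Without its least or its greatest element the order keeps its type: shift only the
  positive or only the negative half by one and fix the other half, so that 0 is never hit.\<close>

lemma word_iso_wpower_omega_omega_star:
  assumes "Linear_order (le w)"
  shows "word_iso (wpower w omega_omega_star) (wconcat w (wpower w omega_omega_star))"
    and "word_iso (wpower w omega_omega_star) (wconcat (wpower w omega_omega_star) w)"
proof -
  note o = Linear_order_omega_omega_star
  let ?g = "\<lambda>i::int. if 0 < i then i - 1 else i"
  have "bij_betw ?g (Field omega_omega_star - {1}) (Field omega_omega_star)"
    unfolding Field_omega_omega_star
    by (rule bij_betw_byWitness[of _ "\<lambda>i. if 0 < i then i + 1 else i"]) auto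
  then show "word_iso (wpower w omega_omega_star) (wconcat w (wpower w omega_omega_star))"
    by (rule word_iso_wpower_first[OF assms o o, rotated 2])
      (unfold Field_omega_omega_star, auto simp: omega_omega_star_def)
  let ?h = "\<lambda>i::int. if i < 0 then i + 1 else i"
  have "bij_betw ?h (Field omega_omega_star - {-1}) (Field omega_omega_star)"
    unfolding Field_omega_omega_star
    by (rule bij_betw_byWitness[of _ "\<lambda>i. if i < 0 then i - 1 else i"]) auto
  then show "word_iso (wpower w omega_omega_star) (wconcat (wpower w omega_omega_star) w)"
    by (rule word_iso_wpower_last[OF assms o o, rotated 2])
      (unfold Field_omega_omega_star, auto simp: omega_omega_star_def)
qed

lemma word_iso_wpower_fin_order_Suc:
  assumes "Linear_order (le w)"
  shows "word_iso (wpower w (fin_order (Suc k))) (wconcat w (wpower w (fin_order k)))"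
proof (rule word_iso_wpower_first[OF assms Linear_order_fin_order Linear_order_fin_order])
  show "bij_betw (\<lambda>i. i - 1) (Field (fin_order (Suc k)) - {0}) (Field (fin_order k))"
    by (rule bij_betw_byWitness[of _ Suc]) auto
qed (unfold Field_fin_order, auto simp: fin_order_def)

lemma word_iso_word_of_list_append:
  assumes "word_iso (word_of_list xs) u" "word_iso (word_of_list ys) v"
  shows "word_iso (word_of_list (xs @ ys)) (wconcat u v)"
proof -
  let ?n = "length xs" and ?k = "length ys"
  obtain f where f: "bij_betw f {..<?n} (wdom u)"
    "\<And>p q. p < ?n \<Longrightarrow> q < ?n \<Longrightarrow> (p, q) \<in> fin_order ?n \<longleftrightarrow> (f p, f q) \<in> le u"
    "\<And>p. p < ?n \<Longrightarrow> lab u (f p) = xs ! p"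
    using assms(1) by (auto simp: word_iso_def)
  obtain g where g: "bij_betw g {..<?k} (wdom v)"
    "\<And>p q. p < ?k \<Longrightarrow> q < ?k \<Longrightarrow> (p, q) \<in> fin_order ?k \<longleftrightarrow> (g p, g q) \<in> le v"
    "\<And>p. p < ?k \<Longrightarrow> lab v (g p) = ys ! p"
    using assms(2) by (auto simp: word_iso_def)
  let ?h = "\<lambda>i. if i < ?n then InL (f i) else InR (g (i - ?n))"
  have "bij_betw ?h ({..<?n} \<union> {?n..<?n + ?k}) (InL ` wdom u \<union> InR ` wdom v)"
  proof (rule bij_betw_combine)
    have "bij_betw (InL \<circ> f) {..<?n} (InL ` wdom u)"
      by (rule bij_betw_trans[OF f(1)]) (auto simp: bij_betw_def inj_on_def)
    then show "bij_betw ?h {..<?n} (InL ` wdom u)"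
      by (rule bij_betw_cong[THEN iffD1, rotated]) simp
    have "bij_betw (\<lambda>i. i - ?n) {?n..<?n + ?k} {..<?k}"
      by (rule bij_betw_byWitness[of _ "\<lambda>i. i + ?n"]) auto
    from bij_betw_trans[OF this g(1)]
    have "bij_betw (InR \<circ> (g \<circ> (\<lambda>i. i - ?n))) {?n..<?n + ?k} (InR ` wdom v)"
      by (rule bij_betw_trans) (auto simp: bij_betw_def inj_on_def)
    then show "bij_betw ?h {?n..<?n + ?k} (InR ` wdom v)"
      by (rule bij_betw_cong[THEN iffD1, rotated]) simp
  qed auto
  moreover have "{..<?n} \<union> {?n..<?n + ?k} = {..<?n + ?k}" by auto
  ultimately have bij: "bij_betw ?h (wdom (word_of_list (xs @ ys))) (wdom (wconcat u v))"
    by (simp add: wdom_wconcat)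
  have fF: "f p \<in> wdom u" if "p < ?n" for p using bij_betwE[OF f(1)] that by auto
  have gF: "g p \<in> wdom v" if "p < ?k" for p using bij_betwE[OF g(1)] that by auto
  show ?thesis
  proof (rule word_isoI[OF bij])
    fix p q assume "p \<in> wdom (word_of_list (xs @ ys))" "q \<in> wdom (word_of_list (xs @ ys))"
    then have pq: "p < ?n + ?k" "q < ?n + ?k" by simp_all
    show "(p, q) \<in> le (word_of_list (xs @ ys)) \<longleftrightarrow> (?h p, ?h q) \<in> le (wconcat u v)"
    proof (cases "p < ?n")
      case True
      then show ?thesis
        using f(2)[of p q] fF[of p] gF[of "q - ?n"] pq by (simp add: le_wconcat fin_order_def)
    next
      case False
      then show ?thesis
        using g(2)[of "p - ?n" "q - ?n"] pq
        by (cases "q < ?n") (simp_all add: le_wconcat fin_order_def, linarith)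
    qed
  next
    fix p assume "p \<in> wdom (word_of_list (xs @ ys))"
    then have "p < ?n + ?k" by simp
    then show "lab (wconcat u v) (?h p) = lab (word_of_list (xs @ ys)) p"
      using f(3)[of p] g(3)[of "p - ?n"] by (simp add: nth_append)
  qed
qed

section \<open>Cutting words at a first or last letter\<close>

abbreviation letter :: "'a \<Rightarrow> ('i pos, 'a) gword" where
  "letter a \<equiv> GWord {(Here, Here)} (\<lambda>_. a)"

abbreviation omega_word :: "'a pterm \<Rightarrow> (int pos, 'a) gword" where
  "omega_word \<alpha> \<equiv> interp omega_omega_star \<alpha>"

lemma wdom_letter [simp]: "Field {(Here, Here)} = {Here}"
  by (auto simp: Field_def)

text \<open>Here \<open>W\<close> is a concatenation isomorphic to \<open>w\<close> via
  \<open>f\<close>, and \<open>i\<close> embeds the factor \<open>x\<close> into \<open>W\<close>;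
  both sides of a cut are instances. Reflexivity of \<open>le x\<close> ensures that no position of
  \<open>S\<close> is lost from the field of the restriction.\<close>

lemma Restr_iso:
  assumes f: "bij_betw f (wdom W) (wdom w)"
      "\<And>p q. p \<in> wdom W \<Longrightarrow> q \<in> wdom W \<Longrightarrow> (p, q) \<in> le W \<longleftrightarrow> (f p, f q) \<in> le w"
      "\<And>p. p \<in> wdom W \<Longrightarrow> lab w (f p) = lab W p"
    and i: "inj_on i (wdom x)" "i ` wdom x \<subseteq> wdom W" "f ` i ` wdom x = S"
      "\<And>p q. p \<in> wdom x \<Longrightarrow> q \<in> wdom x \<Longrightarrow> (p, q) \<in> le x \<longleftrightarrow> (i p, i q) \<in> le W"
      "\<And>p. p \<in> wdom x \<Longrightarrow> lab W (i p) = lab x p"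
    and x: "Linear_order (le x)"
  shows "word_iso (GWord (Restr (le w) S) (lab w)) x"
proof -
  have iW: "i p \<in> wdom W" if "p \<in> wdom x" for p using i(2) that by blast
  have fS: "f (i p) \<in> S" if "p \<in> wdom x" for p using i(3) that by blast
  have inj: "inj_on (f \<circ> i) (wdom x)"
    using i(1,2) f(1) by (intro comp_inj_on) (auto simp: bij_betw_def intro: inj_on_subset)
  have le: "(p, q) \<in> le x \<longleftrightarrow> (f (i p), f (i q)) \<in> Restr (le w) S"
    if "p \<in> wdom x" "q \<in> wdom x" for p q
    using i(4)[OF that] f(2)[OF iW iW, OF that] fS that by simp
  have "Field (Restr (le w) S) = S"
  proof
    show "S \<subseteq> Field (Restr (le w) S)"
    proof
      fix s assume "s \<in> S"
      then obtain p where p: "p \<in> wdom x" "s = f (i p)" using i(3) by blast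
      then have "(s, s) \<in> Restr (le w) S" using le[OF p(1) p(1)] Linear_orderD(1)[OF x p(1)] by simp
      then show "s \<in> Field (Restr (le w) S)" by (rule FieldI1)
    qed
  qed (auto simp: Field_def)
  then have "bij_betw (f \<circ> i) (wdom x) (wdom (GWord (Restr (le w) S) (lab w)))"
    using inj i(3) by (simp add: bij_betw_def image_comp)
  then have "word_iso x (GWord (Restr (le w) S) (lab w))"
    using le i(5) f(3) iW by (intro word_isoI[of "f \<circ> i"]) simp_all
  then show ?thesis by (rule word_iso_sym)
qed

text \<open>In \<open>x a y\<close> the displayed \<open>a\<close> is the first one if
  \<open>x\<close> has none, and the last one if \<open>y\<close> has none. Since the conclusion
  holds up to isomorphism, later proofs find the factors of a word by exhibiting such a splitting
  and never look at positions.\<close>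

lemma split_word:
  assumes iso: "word_iso w (wconcat x (wconcat (letter a) y))"
    and x: "Linear_order (le x)" and y: "Linear_order (le y)"
  shows "a \<notin> alph x \<Longrightarrow> word_iso (XL a w) x" "a \<notin> alph x \<Longrightarrow> word_iso (XR a w) y"
    and "a \<notin> alph y \<Longrightarrow> word_iso (YL a w) x" "a \<notin> alph y \<Longrightarrow> word_iso (YR a w) y"
proof -
  let ?W = "wconcat x (wconcat (letter a) y)"
  obtain f where f: "bij_betw f (wdom ?W) (wdom w)"
      "\<And>p q. p \<in> wdom ?W \<Longrightarrow> q \<in> wdom ?W \<Longrightarrow> (p, q) \<in> le ?W \<longleftrightarrow> (f p, f q) \<in> le w"
      "\<And>p. p \<in> wdom ?W \<Longrightarrow> lab w (f p) = lab ?W p"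
    using word_iso_sym[OF iso] unfolding word_iso_def by blast
  have "Linear_order (le (letter a))"
    by (rule Linear_orderI) auto
  then have W: "Linear_order (le ?W)"
    by (intro Linear_order_wconcat x y)
  have w: "Linear_order (le w)"
    by (rule Linear_order_word_iso[OF word_iso_sym[OF iso] W])
  let ?p = "InR (InL Here)"
  have dom: "wdom ?W = InL ` wdom x \<union> {?p} \<union> InR ` InR ` wdom y"
    by (simp add: wdom_wconcat image_Un Un_assoc)
  have p: "f ?p \<in> wdom w" "lab w (f ?p) = a"
    using bij_betwE[OF f(1)] f(3)[of ?p] by (auto simp: dom)
  have wdom: "wdom w = f ` wdom ?W" using f(1) by (simp add: bij_betw_def)
  have le_y: "(f ?p, f (InR (InR q))) \<in> le w" "(f (InR (InR q)), f ?p) \<notin> le w"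
    if "q \<in> wdom y" for q
    using that f(2)[symmetric] by (simp_all add: dom) (simp_all add: le_wconcat wdom_wconcat)
  have le_x: "(f (InL q), f ?p) \<in> le w" "(f ?p, f (InL q)) \<notin> le w"
    if "q \<in> wdom x" for q
    using that f(2)[symmetric] by (simp_all add: dom) (simp_all add: le_wconcat wdom_wconcat)
  have le_p: "(f ?p, f ?p) \<in> le w"
    by (rule Linear_orderD(1)[OF w p(1)])
  have cases: "q \<in> f ` InL ` wdom x \<or> q = f ?p \<or> q \<in> f ` InR ` InR ` wdom y" if "q \<in> wdom w" for q
    using that unfolding wdom dom by blast
  have "underS (le w) (f ?p) = f ` InL ` wdom x"
  proof (intro equalityI subsetI)
    fix q assume q: "q \<in> underS (le w) (f ?p)"
    then have "(q, f ?p) \<in> le w" "q \<noteq> f ?p" by (auto simp: underS_def)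
    moreover from this have "q \<in> wdom w" by (auto intro: FieldI1)
    ultimately show "q \<in> f ` InL ` wdom x" using cases[of q] le_y(2) by blast
  qed (use le_x le_p in \<open>force simp: underS_def\<close>)
  then have left: "word_iso (left_of w (f ?p)) x"
    unfolding left_of_def
    by (intro Restr_iso[OF f _ _ _ _ _ x, where i = InL])
      (auto simp: inj_on_def dom le_wconcat)
  have "aboveS (le w) (f ?p) = f ` (InR \<circ> InR) ` wdom y"
    unfolding image_comp[symmetric]
  proof (intro equalityI subsetI)
    fix q assume q: "q \<in> aboveS (le w) (f ?p)"
    then have "(f ?p, q) \<in> le w" "q \<noteq> f ?p" by (auto simp: aboveS_def)
    moreover from this have "q \<in> wdom w" by (auto intro: FieldI2)
    ultimately show "q \<in> f ` InR ` InR ` wdom y" using cases[of q] le_x(2) by blast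
  qed (use le_y le_p in \<open>force simp: aboveS_def\<close>)
  then have right: "word_iso (right_of w (f ?p)) y"
    unfolding right_of_def
    by (intro Restr_iso[OF f _ _ _ _ _ y, where i = "InR \<circ> InR"])
      (auto simp: inj_on_def dom le_wconcat)
  have first: "first_pos w a = f ?p" if "a \<notin> alph x"
    unfolding first_pos_def
  proof (rule the_equality)
    show *: "f ?p \<in> wdom w \<and> lab w (f ?p) = a \<and> (\<forall>q\<in>wdom w. lab w q = a \<longrightarrow> (f ?p, q) \<in> le w)"
    proof (intro conjI ballI impI p)
      fix q assume q: "q \<in> wdom w" "lab w q = a"
      have "q \<notin> f ` InL ` wdom x"
      proof
        assume "q \<in> f ` InL ` wdom x"
        then obtain z where z: "z \<in> wdom x" "q = f (InL z)" by blast
        then have "lab x z = a" using f(3)[of "InL z"] q(2) by (simp add: dom)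
        then show False using that z(1) by (auto simp: alph_def)
      qed
      then show "(f ?p, q) \<in> le w" using cases[OF q(1)] le_y(1) le_p by blast
    qed
    show "q = f ?p"
      if "q \<in> wdom w \<and> lab w q = a \<and> (\<forall>q'\<in>wdom w. lab w q' = a \<longrightarrow> (q, q') \<in> le w)" for q
      using that * by (intro Linear_orderD(3)[OF w]) blast+
  qed
  have last: "last_pos w a = f ?p" if "a \<notin> alph y"
    unfolding last_pos_def
  proof (rule the_equality)
    show *: "f ?p \<in> wdom w \<and> lab w (f ?p) = a \<and> (\<forall>q\<in>wdom w. lab w q = a \<longrightarrow> (q, f ?p) \<in> le w)"
    proof (intro conjI ballI impI p)
      fix q assume q: "q \<in> wdom w" "lab w q = a"
      have "q \<notin> f ` InR ` InR ` wdom y"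
      proof
        assume "q \<in> f ` InR ` InR ` wdom y"
        then obtain z where z: "z \<in> wdom y" "q = f (InR (InR z))" by blast
        then have "lab y z = a" using f(3)[of "InR (InR z)"] q(2) by (simp add: dom)
        then show False using that z(1) by (auto simp: alph_def)
      qed
      then show "(q, f ?p) \<in> le w" using cases[OF q(1)] le_x(1) le_p by blast
    qed
    show "q = f ?p"
      if "q \<in> wdom w \<and> lab w q = a \<and> (\<forall>q'\<in>wdom w. lab w q' = a \<longrightarrow> (q', q) \<in> le w)" for q
      using that * by (intro Linear_orderD(3)[OF w]) blast+
  qed
  show "a \<notin> alph x \<Longrightarrow> word_iso (XL a w) x" "a \<notin> alph x \<Longrightarrow> word_iso (XR a w) y"
    using left right by (simp_all add: first)
  show "a \<notin> alph y \<Longrightarrow> word_iso (YL a w) x" "a \<notin> alph y \<Longrightarrow> word_iso (YR a w) y"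
    using left right by (simp_all add: last)
qed

subsection \<open>Factors of terms\<close>

lemma Linear_order_omega_word: "Linear_order (le (omega_word \<alpha>))"
  by (rule Linear_order_interp[OF Linear_order_omega_omega_star])

lemma alph_omega_word: "alph (omega_word \<alpha>) = set_pterm \<alpha>"
proof (induction \<alpha>)
  case (Pi \<alpha>)
  \<comment> \<open>A power over the empty order would be empty and lose its alphabet.\<close>
  have "Field omega_omega_star \<noteq> {}" unfolding Field_omega_omega_star by (metis Compl_iff empty_iff singletonD zero_neq_one)
  then show ?case
    using Pi alph_wpower[OF Linear_order_omega_word[of \<alpha>] Linear_order_omega_omega_star] by simp
qed (simp_all add: alph_def[of "GWord _ _"] alph_wconcat)

text \<open>
  The flag \<open>d\<close> is the direction from which a word is read: \<open>True\<close> for \<open>X\<close> and \<open>False\<close> for \<open>Y\<close>. Then \<open>near\<close>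
  and \<open>far\<close> are \<open>X\<^sup>L\<close> and \<open>X\<^sup>R\<close>, or \<open>Y\<^sup>R\<close> and \<open>Y\<^sup>L\<close>, respectively. They are meaningful for letters that
  occur in the term only.
\<close>

definition cat :: "bool \<Rightarrow> 'a pterm \<Rightarrow> 'a pterm \<Rightarrow> 'a pterm" where
  "cat d \<alpha> \<beta> = (if d then Cat \<alpha> \<beta> else Cat \<beta> \<alpha>)"

primrec near :: "bool \<Rightarrow> 'a \<Rightarrow> 'a pterm \<Rightarrow> 'a pterm" where
  "near d a Eps = Eps"
| "near d a (Letter b) = Eps"
| "near d a (Cat \<alpha> \<beta>) =
    (if d then if a \<in> set_pterm \<alpha> then near d a \<alpha> else Cat \<alpha> (near d a \<beta>)
     else if a \<in> set_pterm \<beta> then near d a \<beta> else Cat (near d a \<alpha>) \<beta>)"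
| "near d a (Pi \<alpha>) = near d a \<alpha>"

primrec far :: "bool \<Rightarrow> 'a \<Rightarrow> 'a pterm \<Rightarrow> 'a pterm" where
  "far d a Eps = Eps"
| "far d a (Letter b) = Eps"
| "far d a (Cat \<alpha> \<beta>) =
    (if d then if a \<in> set_pterm \<alpha> then Cat (far d a \<alpha>) \<beta> else far d a \<beta>
     else if a \<in> set_pterm \<beta> then Cat \<alpha> (far d a \<beta>) else far d a \<alpha>)"
| "far d a (Pi \<alpha>) = cat d (far d a \<alpha>) (Pi \<alpha>)"

lemma set_pterm_cat [simp]: "set_pterm (cat d \<alpha> \<beta>) = set_pterm \<alpha> \<union> set_pterm \<beta>"
  by (auto simp: cat_def)

lemma near_cat: "near d a (cat d \<alpha> \<beta>) = (if a \<in> set_pterm \<alpha> then near d a \<alpha> else cat d \<alpha> (near d a \<beta>))"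
  by (simp add: cat_def)

lemma far_cat: "far d a (cat d \<alpha> \<beta>) = (if a \<in> set_pterm \<alpha> then cat d (far d a \<alpha>) \<beta> else far d a \<beta>)"
  by (simp add: cat_def)

lemma Cat_eq_cat: "Cat \<alpha> \<beta> = (if d then cat d \<alpha> \<beta> else cat d \<beta> \<alpha>)"
  by (simp add: cat_def)

lemma omega_word_cat_cong:
  assumes "word_iso (omega_word \<alpha>) (omega_word \<alpha>')" "word_iso (omega_word \<beta>) (omega_word \<beta>')"
  shows "word_iso (omega_word (cat d \<alpha> \<beta>)) (omega_word (cat d \<alpha>' \<beta>'))"
  using assms by (simp add: cat_def word_iso_wconcat)

lemma omega_word_cat_assoc:
  "word_iso (omega_word (cat d (cat d \<alpha> \<beta>) \<gamma>)) (omega_word (cat d \<alpha> (cat d \<beta> \<gamma>)))"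
  using word_iso_wconcat_assoc word_iso_sym by (simp add: cat_def) blast

lemma omega_word_Pi_unfold: "word_iso (omega_word (Pi \<alpha>)) (omega_word (cat d \<alpha> (Pi \<alpha>)))"
  by (simp add: cat_def word_iso_wpower_omega_omega_star Linear_order_omega_word)

text \<open>A concatenation is rebracketed around the factor that holds the occurrence of
  \<open>a\<close> nearest to side \<open>d\<close>. A power is unrolled once on that side, which
  leaves a complete power inside the far factor. Together with \<open>not_in_near\<close> this makes
  \<open>near\<close> and \<open>far\<close> the factors of the word.\<close>

lemma near_far_iso:
  "a \<in> set_pterm \<alpha> \<Longrightarrow>
    word_iso (omega_word \<alpha>) (omega_word (cat d (near d a \<alpha>) (cat d (Letter a) (far d a \<alpha>))))"
proof (induction \<alpha>)
  case (Letter b)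
  then have eq: "cat d (near d a (Letter b)) (cat d (Letter a) (far d a (Letter b))) =
      cat d Eps (cat d (Letter a) Eps)" and b: "b = a" by simp_all
  have 2: "word_iso w (wconcat (omega_word Eps) w)" for w :: "(int pos, 'a) gword"
    by (rule word_isoI[of InR]) (simp_all add: wdom_wconcat le_wconcat bij_betw_def inj_on_def)
  have 3: "word_iso w (wconcat w (omega_word Eps))" for w :: "(int pos, 'a) gword"
    by (rule word_isoI[of InL]) (simp_all add: wdom_wconcat le_wconcat bij_betw_def inj_on_def)
  show ?case
    unfolding eq b using word_iso_trans[OF 2 3] word_iso_trans[OF 3 2] by (simp add: cat_def)
next
  case (Cat \<alpha>1 \<alpha>2)
  \<comment> \<open>Rename the two factors such that \<beta> is read first from side
    \<open>d\<close>; one argument then covers both directions.\<close>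
  obtain \<beta> \<gamma> where c: "Cat \<alpha>1 \<alpha>2 = cat d \<beta> \<gamma>" and
    IH: "a \<in> set_pterm \<beta> \<Longrightarrow> word_iso (omega_word \<beta>) (omega_word (cat d (near d a \<beta>) (cat d (Letter a) (far d a \<beta>))))"
    "a \<in> set_pterm \<gamma> \<Longrightarrow> word_iso (omega_word \<gamma>) (omega_word (cat d (near d a \<gamma>) (cat d (Letter a) (far d a \<gamma>))))"
    using Cat.IH Cat_eq_cat[of \<alpha>1 \<alpha>2 d] by (cases d) auto
  have a: "a \<in> set_pterm \<beta> \<or> a \<in> set_pterm \<gamma>" using Cat.prems unfolding c by simp
  show ?case
  proof (cases "a \<in> set_pterm \<beta>")
    case True
    show ?thesis
      unfolding c near_cat far_cat using True
      by simp (rule word_iso_trans[OF omega_word_cat_cong[OF IH(1) word_iso_refl]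
        word_iso_trans[OF omega_word_cat_assoc omega_word_cat_cong[OF word_iso_refl omega_word_cat_assoc]]])
  next
    case False
    then show ?thesis
      unfolding c near_cat far_cat using a
      by simp (rule word_iso_trans[OF omega_word_cat_cong[OF word_iso_refl IH(2)]
        word_iso_sym[OF omega_word_cat_assoc]])
  qed
next
  case (Pi \<alpha>)
  then have IH: "word_iso (omega_word \<alpha>) (omega_word (cat d (near d a \<alpha>) (cat d (Letter a) (far d a \<alpha>))))"
    by simp
  show ?case
    by (simp del: interp.simps) (rule word_iso_trans[OF word_iso_trans[OF omega_word_Pi_unfold omega_word_cat_cong[OF IH word_iso_refl]]
        word_iso_trans[OF omega_word_cat_assoc omega_word_cat_cong[OF word_iso_refl omega_word_cat_assoc]]])
qed simp

lemma not_in_near: "a \<notin> set_pterm (near d a \<alpha>)"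
  by (induction \<alpha>) auto

text \<open>The mutual recursion of \<open>eqX\<close> (\<open>d\<close> true) and
  \<open>eqY\<close> (\<open>d\<close> false) as a single one, over any objects with an alphabet and
  near and far factors. It will be used for lists and for terms. The level \<open>m\<close> drops
  exactly when the direction turns.\<close>

fun factor_eq :: "('w \<Rightarrow> 'a set) \<Rightarrow> (bool \<Rightarrow> 'a \<Rightarrow> 'w \<Rightarrow> 'w) \<Rightarrow> (bool \<Rightarrow> 'a \<Rightarrow> 'w \<Rightarrow> 'w) \<Rightarrow>
    bool \<Rightarrow> nat \<Rightarrow> nat \<Rightarrow> 'w \<Rightarrow> 'w \<Rightarrow> bool" where
  "factor_eq al nr fr d 0 n u v = True"
| "factor_eq al nr fr d (Suc m) 0 u v = True"
| "factor_eq al nr fr d (Suc m) (Suc n) u v \<longleftrightarrow> al u = al v \<and> factor_eq al nr fr (\<not> d) m n u v \<and>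
     (\<forall>a\<in>al u. factor_eq al nr fr (\<not> d) m n (nr d a u) (nr d a v) \<and>
       factor_eq al nr fr d (Suc m) n (fr d a u) (fr d a v))"

lemma factor_eq_0_right [simp]: "factor_eq al nr fr d m 0 u v"
  by (cases m) auto

lemma eqX_0_right [simp]: "eqX m 0 u v" "eqY m 0 u v"
  by (cases m; simp)+

lemma factor_eq_antimono:
  "factor_eq al nr fr d m n u v \<Longrightarrow> n' \<le> n \<Longrightarrow> factor_eq al nr fr d m n' u v"
proof (induction al nr fr d m n u v arbitrary: n' rule: factor_eq.induct)
  case (3 al nr fr d m n u v)
  then show ?case by (cases n') auto
qed auto

lemma split_omega_word:
  assumes w: "word_iso w (omega_word (cat d \<nu> (cat d (Letter a) \<rho>)))" and a: "a \<notin> set_pterm \<nu>"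
  shows "word_iso (if d then XL a w else YR a w) (omega_word \<nu>)"
    and "word_iso (if d then XR a w else YL a w) (omega_word \<rho>)"
proof -
  note split = split_word[OF _ Linear_order_omega_word Linear_order_omega_word,
      unfolded alph_omega_word]
  have "word_iso (if d then XL a w else YR a w) (omega_word \<nu>) \<and>
      word_iso (if d then XR a w else YL a w) (omega_word \<rho>)"
  proof (cases d)
    case True
    then have iso: "word_iso w (wconcat (omega_word \<nu>) (wconcat (letter a) (omega_word \<rho>)))"
      using w by (simp add: cat_def)
    show ?thesis using split(1,2)[OF iso a] True by simp
  next
    case False
    then have "word_iso w (wconcat (wconcat (omega_word \<rho>) (letter a)) (omega_word \<nu>))"
      using w by (simp add: cat_def)
    then have iso: "word_iso w (wconcat (omega_word \<rho>) (wconcat (letter a) (omega_word \<nu>)))"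
      by (rule word_iso_trans) (rule word_iso_wconcat_assoc)
    show ?thesis using split(3,4)[OF iso a] False by simp
  qed
  then show "word_iso (if d then XL a w else YR a w) (omega_word \<nu>)"
    and "word_iso (if d then XR a w else YL a w) (omega_word \<rho>)" by simp_all
qed

text \<open>Each object \<open>s\<close> stands for the word of the term \<open>rep s\<close>. By
  induction on \<open>n\<close>: the splittings assumed for \<open>rep\<close> are those at first
  and last letters, so \<open>split_omega_word\<close> matches the factors on both sides. The words
  need only be isomorphic to those of the terms, as this is what passes to factors.\<close>

lemma eqX_iff_factor_eq:
  fixes rep :: "'x \<Rightarrow> 'a pterm" and w :: "('p, 'a) gword" and w' :: "('q, 'a) gword"
  assumes al: "\<And>s. al s = set_pterm (rep s)"
    and split: "\<And>s d a. a \<in> al s \<Longrightarrow> word_iso (omega_word (rep s))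
        (omega_word (cat d (rep (nr d a s)) (cat d (Letter a) (rep (fr d a s)))))"
    and nr: "\<And>s d a. a \<in> al s \<Longrightarrow> a \<notin> al (nr d a s)"
  shows "word_iso w (omega_word (rep s)) \<Longrightarrow> word_iso w' (omega_word (rep t)) \<Longrightarrow>
    (if d then eqX m n w w' else eqY m n w w') \<longleftrightarrow> factor_eq al nr fr d m n s t"
proof (induction n arbitrary: d m w w' s t)
  case (Suc n)
  have alph: "alph w = al s" "alph w' = al t"
    using Suc.prems[THEN alph_word_iso] by (simp_all add: alph_omega_word al)
  show ?case
  proof (cases m)
    case (Suc k)
    show ?thesis
    proof (cases "al s = al t")
      case True
      have near: "(if \<not> d then eqX k n (YR a w) (YR a w') else eqY k n (XL a w) (XL a w')) \<longleftrightarrow>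
          factor_eq al nr fr (\<not> d) k n (nr d a s) (nr d a t)"
        and far: "(if d then eqX m n (XR a w) (XR a w') else eqY m n (YL a w) (YL a w')) \<longleftrightarrow>
          factor_eq al nr fr d m n (fr d a s) (fr d a t)"
        if s: "a \<in> al s" for a
      proof -
        have t: "a \<in> al t" using s True by simp
        note w = word_iso_trans[OF Suc.prems(1) split[OF s, of d]] nr[OF s, of d, unfolded al]
        note w' = word_iso_trans[OF Suc.prems(2) split[OF t, of d]] nr[OF t, of d, unfolded al]
        show "(if \<not> d then eqX k n (YR a w) (YR a w') else eqY k n (XL a w) (XL a w')) \<longleftrightarrow>
          factor_eq al nr fr (\<not> d) k n (nr d a s) (nr d a t)"
          using Suc.IH[OF split_omega_word(1)[OF w] split_omega_word(1)[OF w'], of "\<not> d" k] by (cases d) simp_all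
        show "(if d then eqX m n (XR a w) (XR a w') else eqY m n (YL a w) (YL a w')) \<longleftrightarrow>
          factor_eq al nr fr d m n (fr d a s) (fr d a t)"
          using Suc.IH[OF split_omega_word(2)[OF w] split_omega_word(2)[OF w'], of d m] by (cases d) simp_all
      qed
      show ?thesis
        using near far Suc.IH[OF Suc.prems, of "\<not> d" k] True
        by (cases d) (auto simp: Suc alph)
    qed (auto simp: Suc alph)
  qed simp
qed simp

section \<open>Finite words as lists and as terms without powers\<close>

primrec word_term :: "'a list \<Rightarrow> 'a pterm" where
  "word_term [] = Eps"
| "word_term (a # xs) = Cat (Letter a) (word_term xs)"

lemma set_word_term [simp]: "set_pterm (word_term xs) = set xs"
  by (induction xs) simp_all

definition app :: "bool \<Rightarrow> 'a list \<Rightarrow> 'a list \<Rightarrow> 'a list" where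
  "app d xs ys = (if d then xs @ ys else ys @ xs)"

definition near_list :: "bool \<Rightarrow> 'a \<Rightarrow> 'a list \<Rightarrow> 'a list" where
  "near_list d a xs = (if d then takeWhile (\<lambda>b. b \<noteq> a) xs
     else rev (takeWhile (\<lambda>b. b \<noteq> a) (rev xs)))"

definition far_list :: "bool \<Rightarrow> 'a \<Rightarrow> 'a list \<Rightarrow> 'a list" where
  "far_list d a xs = (if d then tl (dropWhile (\<lambda>b. b \<noteq> a) xs)
     else rev (tl (dropWhile (\<lambda>b. b \<noteq> a) (rev xs))))"

lemma set_app [simp]: "set (app d xs ys) = set xs \<union> set ys"
  by (auto simp: app_def)

lemma app_assoc: "app d (app d xs ys) zs = app d xs (app d ys zs)"
  by (simp add: app_def)

lemma app_Nil [simp]: "app d [] xs = xs" "app d xs [] = xs"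
  by (simp_all add: app_def)

lemma near_list_app: "a \<notin> set xs \<Longrightarrow> near_list d a (app d xs (app d [a] ys)) = xs"
  and far_list_app: "a \<notin> set xs \<Longrightarrow> far_list d a (app d xs (app d [a] ys)) = ys"
proof -
  have "takeWhile (\<lambda>b. b \<noteq> a) (xs @ a # ys) = xs" "dropWhile (\<lambda>b. b \<noteq> a) (xs @ a # ys) = a # ys"
    if "a \<notin> set xs" for xs ys
    using that by (induction xs) auto
  then show "a \<notin> set xs \<Longrightarrow> near_list d a (app d xs (app d [a] ys)) = xs"
    and "a \<notin> set xs \<Longrightarrow> far_list d a (app d xs (app d [a] ys)) = ys"
    unfolding near_list_def far_list_def app_def by simp_all
qed

lemma list_split:
  assumes "a \<in> set xs"
  obtains ys zs where "xs = app d ys (app d [a] zs)" "a \<notin> set ys"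
proof (cases d)
  case True
  then show ?thesis using split_list_first[OF assms] that by (auto simp: app_def)
next
  case False
  then show ?thesis using split_list_last[OF assms] that by (auto simp: app_def)
qed

lemma list_eq_near_far:
  assumes "a \<in> set xs"
  shows "xs = app d (near_list d a xs) (app d [a] (far_list d a xs))" "a \<notin> set (near_list d a xs)"
proof -
  obtain ys zs where "xs = app d ys (app d [a] zs)" "a \<notin> set ys"
    using list_split[OF assms] by blast
  then show "xs = app d (near_list d a xs) (app d [a] (far_list d a xs))" "a \<notin> set (near_list d a xs)"
    by (simp_all add: near_list_app far_list_app)
qed

lemma word_iso_singleton: "word_iso (word_of_list [a]) (letter a)"
proof (rule word_isoI[of "\<lambda>_. Here"])
  have "{..<Suc 0} = {0}" by auto
  then show "bij_betw (\<lambda>_. Here) (wdom (word_of_list [a])) (wdom (letter a))"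
    by (simp add: bij_betw_def)
  show "(p, q) \<in> le (word_of_list [a]) \<longleftrightarrow> (Here, Here) \<in> le (letter a)"
    if "p \<in> wdom (word_of_list [a])" "q \<in> wdom (word_of_list [a])" for p q
    using that by simp (simp add: fin_order_def)
qed simp

text \<open>Without \<open>Pi\<close> the order \<open>r\<close> never enters, so one term
  represents the list over every order. Lists thus inherit their factorizations from terms over
  \<open>omega_omega_star\<close>.\<close>

lemma word_iso_word_term: "word_iso (word_of_list xs) (interp r (word_term xs))"
proof (induction xs)
  case Nil
  show ?case by (rule word_isoI[of "\<lambda>_. undefined"]) (simp_all add: bij_betw_def)
next
  case (Cons a xs)
  from word_iso_word_of_list_append[OF word_iso_singleton Cons] show ?case by simp
qed

lemma word_iso_word_of_list_app:
  assumes "word_iso (word_of_list xs) (omega_word \<alpha>)" "word_iso (word_of_list ys) (omega_word \<beta>)"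
  shows "word_iso (word_of_list (app d xs ys)) (omega_word (cat d \<alpha> \<beta>))"
  using word_iso_word_of_list_append[OF assms] word_iso_word_of_list_append[OF assms(2,1)]
  by (simp add: app_def cat_def)

abbreviation list_eq :: "bool \<Rightarrow> nat \<Rightarrow> nat \<Rightarrow> 'a list \<Rightarrow> 'a list \<Rightarrow> bool" where
  "list_eq \<equiv> factor_eq set near_list far_list"

abbreviation term_eq :: "bool \<Rightarrow> nat \<Rightarrow> nat \<Rightarrow> 'a pterm \<Rightarrow> 'a pterm \<Rightarrow> bool" where
  "term_eq \<equiv> factor_eq set_pterm near far"

lemma eqX_word_of_list: "eqX m n (word_of_list xs) (word_of_list ys) \<longleftrightarrow> list_eq True m n xs ys"
proof -
  have "word_iso (omega_word (word_term xs)) (omega_word (cat d (word_term (near_list d a xs))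
      (cat d (Letter a) (word_term (far_list d a xs)))))" if "a \<in> set xs" for d a and xs :: "'a list"
  proof -
    have "word_iso (word_of_list [a]) (omega_word (Letter a))"
      using word_iso_singleton by simp
    note word_iso_word_of_list_app[OF word_iso_word_term
        word_iso_word_of_list_app[OF this word_iso_word_term], of d "near_list d a xs" d "far_list d a xs"]
    then show ?thesis
      unfolding list_eq_near_far(1)[OF that, of d, symmetric]
      by (rule word_iso_trans[OF word_iso_sym[OF word_iso_word_term]])
  qed
  then show ?thesis
    using eqX_iff_factor_eq[of set word_term near_list far_list, OF _ _ _ word_iso_word_term word_iso_word_term,
      of True m n xs ys]
    by (simp add: list_eq_near_far(2))
qed

lemma eqX_omega_word: "eqX m n (omega_word \<alpha>) (omega_word \<beta>) \<longleftrightarrow> term_eq True m n \<alpha> \<beta>"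
  using eqX_iff_factor_eq[of set_pterm id near far, OF _ _ _ word_iso_refl word_iso_refl, of True m n \<alpha> \<beta>]
  by (simp add: near_far_iso not_in_near)

subsection \<open>Congruence properties on terms\<close>

lemma factor_eq_SucD:
  assumes "factor_eq al nr fr d (Suc m) (Suc n) u v"
  shows "al u = al v" "factor_eq al nr fr (\<not> d) m n u v"
    "a \<in> al u \<Longrightarrow> factor_eq al nr fr (\<not> d) m n (nr d a u) (nr d a v)"
    "a \<in> al u \<Longrightarrow> factor_eq al nr fr d (Suc m) n (fr d a u) (fr d a v)"
  using assms by (simp_all only: factor_eq.simps)

lemma factor_eq_SucI:
  assumes "al u = al v" "factor_eq al nr fr (\<not> d) m n u v"
    "\<And>a. a \<in> al u \<Longrightarrow> factor_eq al nr fr (\<not> d) m n (nr d a u) (nr d a v)"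
    "\<And>a. a \<in> al u \<Longrightarrow> factor_eq al nr fr d (Suc m) n (fr d a u) (fr d a v)"
  shows "factor_eq al nr fr d (Suc m) (Suc n) u v"
  using assms by (simp only: factor_eq.simps) blast

text \<open>If the nearest \<open>a\<close> lies in the second factor, the near factor contains the
  first factor entirely, and this is compared by the clause on whole words with \<open>d\<close>
  turned. There the concatenation is still in the order of the old \<open>d\<close>, which is why
  its side \<open>e\<close> varies independently of \<open>d\<close>.\<close>

lemma term_eq_cat:
  fixes \<alpha> \<alpha>' \<beta> \<beta>' :: "'a pterm"
  shows "term_eq d m n \<alpha> \<alpha>' \<Longrightarrow> term_eq d m n \<beta> \<beta>' \<Longrightarrow> term_eq d m n (cat e \<alpha> \<beta>) (cat e \<alpha>' \<beta>')"
proof (induction n arbitrary: d m e \<alpha> \<alpha>' \<beta> \<beta>')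
  case (Suc n)
  show ?case
  proof (cases m)
    case m: (Suc k)
    have cat: "term_eq d m (Suc n) (cat d \<gamma> \<delta>) (cat d \<gamma>' \<delta>')"
      if \<gamma>: "term_eq d m (Suc n) \<gamma> \<gamma>'" and \<delta>: "term_eq d m (Suc n) \<delta> \<delta>'" for \<gamma> \<gamma>' \<delta> \<delta>' :: "'a pterm"
    proof -
      note \<gamma>D = factor_eq_SucD[OF \<gamma>[unfolded m]] and \<delta>D = factor_eq_SucD[OF \<delta>[unfolded m]]
      have \<delta>n: "term_eq d (Suc k) n \<delta> \<delta>'" using factor_eq_antimono[OF \<delta>] m by simp
      show ?thesis
        unfolding m
      proof (rule factor_eq_SucI)
        show "set_pterm (cat d \<gamma> \<delta>) = set_pterm (cat d \<gamma>' \<delta>')" by (simp add: \<gamma>D(1) \<delta>D(1))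
        show "term_eq (\<not> d) k n (cat d \<gamma> \<delta>) (cat d \<gamma>' \<delta>')" by (rule Suc.IH[OF \<gamma>D(2) \<delta>D(2)])
        fix a assume a: "a \<in> set_pterm (cat d \<gamma> \<delta>)"
        show "term_eq (\<not> d) k n (near d a (cat d \<gamma> \<delta>)) (near d a (cat d \<gamma>' \<delta>'))"
        proof (cases "a \<in> set_pterm \<gamma>")
          case True
          then show ?thesis using \<gamma>D(3)[OF True] by (simp add: near_cat \<gamma>D(1))
        next
          case False
          then show ?thesis using Suc.IH[OF \<gamma>D(2) \<delta>D(3)] a by (simp add: near_cat \<gamma>D(1))
        qed
        show "term_eq d (Suc k) n (far d a (cat d \<gamma> \<delta>)) (far d a (cat d \<gamma>' \<delta>'))"
        proof (cases "a \<in> set_pterm \<gamma>")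
          case True
          then show ?thesis using Suc.IH[OF \<gamma>D(4)[OF True] \<delta>n] by (simp add: far_cat \<gamma>D(1))
        next
          case False
          then show ?thesis using \<delta>D(4) a by (simp add: far_cat \<gamma>D(1))
        qed
      qed
    qed
    show ?thesis
      using cat[OF Suc.prems] cat[OF Suc.prems(2,1)] by (cases d; cases e) (auto simp: cat_def)
  qed simp
qed simp

text \<open>The near factor of a power is that of its base, and the far factor is that of the base
  followed by the same power, which has one step of \<open>n\<close> less to satisfy.\<close>

lemma term_eq_Pi: "term_eq d m n \<alpha> \<alpha>' \<Longrightarrow> term_eq d m n (Pi \<alpha>) (Pi \<alpha>')"
proof (induction n arbitrary: d m \<alpha> \<alpha>')
  case (Suc n)
  have "term_eq d m n \<alpha> \<alpha>'" using factor_eq_antimono[OF Suc.prems] by simp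
  then show ?case
    using Suc.prems by (cases m) (auto intro!: term_eq_cat Suc.IH)
qed simp

text \<open>Only the tail needs the weaker relation: moving away from side \<open>d\<close> never leaves the
  first copies of the power.\<close>

lemma term_eq_cat_Pi_cat:
  assumes \<rho>: "term_eq d (Suc m) n \<rho> \<rho>'" and \<delta>: "\<And>n. term_eq d (Suc m) n \<delta> \<delta>'"
    and \<zeta>: "\<And>n. term_eq (\<not> d) m n \<zeta> \<zeta>'"
    and alph: "set_pterm \<zeta> \<subseteq> set_pterm \<delta>" "set_pterm \<zeta>' \<subseteq> set_pterm \<delta>"
  shows "term_eq d (Suc m) n (cat d (cat d \<rho> (Pi \<delta>)) \<zeta>) (cat d (cat d \<rho>' (Pi \<delta>')) \<zeta>')"
  using \<rho>
proof (induction n arbitrary: \<rho> \<rho>')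
  case (Suc n)
  have \<delta>_alph: "set_pterm \<delta>' = set_pterm \<delta>" using \<delta>[of "Suc 0"] by simp
  have \<delta>_near: "term_eq (\<not> d) m n (near d a \<delta>) (near d a \<delta>')"
    and \<delta>_far: "term_eq d (Suc m) n (far d a \<delta>) (far d a \<delta>')" if "a \<in> set_pterm \<delta>" for a
    using factor_eq_SucD(3,4)[OF \<delta> that] .
  have \<delta>_not: "term_eq (\<not> d) m n \<delta> \<delta>'" by (rule factor_eq_SucD(2)[OF \<delta>])
  \<comment> \<open>As the tail has no letters of its own, every cut falls into \<rho> or into the
    first copy of \<delta>. The far factor has the same shape again, with the far factor of \<rho>
    or of \<delta> in the place of \<rho>.\<close>
  have alph': "a \<in> set_pterm \<zeta> \<Longrightarrow> a \<in> set_pterm \<delta>" "a \<in> set_pterm \<zeta>' \<Longrightarrow> a \<in> set_pterm \<delta>" for a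
    using alph by blast+
  show ?case
    using Suc.prems
    by (auto simp: near_cat far_cat \<delta>_alph alph' intro!: Suc.IH term_eq_cat term_eq_Pi \<zeta> \<delta>_near \<delta>_far \<delta>_not)
qed simp

subsection \<open>Factors of lists\<close>

text \<open>Seen from side \<open>d\<close>, the nearest \<open>b\<close> comes before the nearest
  \<open>a\<close>; hence it is the same position in \<open>u\<close> and in the near factor, and
  the cuts at \<open>a\<close> and at \<open>b\<close> commute.\<close>

lemma near_list_near_list:
  assumes "a \<in> set u" "b \<in> set (near_list d a u)"
  shows "b \<in> set u" "a \<in> set (far_list d b u)"
    "near_list d b (near_list d a u) = near_list d b u"
    "far_list d b (near_list d a u) = near_list d a (far_list d b u)"
proof -
  obtain x z where u: "u = app d x (app d [a] z)" and x: "a \<notin> set x"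
    using list_split[OF assms(1)] by blast
  have near: "near_list d a u = x" unfolding u using x by (rule near_list_app)
  then have "b \<in> set x" using assms(2) by simp
  then obtain y y' where x': "x = app d y (app d [b] y')" and y: "b \<notin> set y"
    using list_split[of b x] by blast
  have u': "u = app d y (app d [b] (app d y' (app d [a] z)))"
    unfolding u x' by (simp add: app_assoc)
  have near_b: "near_list d b u = y" "far_list d b u = app d y' (app d [a] z)"
    unfolding u' using y by (simp_all only: near_list_app far_list_app not_False_eq_True)
  show "b \<in> set u" "a \<in> set (far_list d b u)" by (simp_all add: near_b) (simp add: u')
  show "near_list d b (near_list d a u) = near_list d b u"
    unfolding near near_b unfolding x' using y by (rule near_list_app)
  have "a \<notin> set y'" using x x' by simp
  then show "far_list d b (near_list d a u) = near_list d a (far_list d b u)"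
    unfolding near near_b unfolding x' using y by (simp add: near_list_app far_list_app)
qed

text \<open>At level 1 this fails: not even the alphabets of the near factors need to agree.\<close>

lemma list_eq_near_list:
  "list_eq d (Suc (Suc m)) (Suc n) u v \<Longrightarrow> a \<in> set u \<Longrightarrow>
    list_eq d (Suc (Suc m)) n (near_list d a u) (near_list d a v)"
proof (induction n arbitrary: u v)
  case (Suc n)
  have av: "a \<in> set v" using Suc.prems by simp
  have near: "list_eq (\<not> d) (Suc m) (Suc n) (near_list d b u) (near_list d b v)"
    and far: "list_eq d (Suc (Suc m)) (Suc n) (far_list d b u) (far_list d b v)" if "b \<in> set u" for b
    using factor_eq_SucD(3,4)[OF Suc.prems(1) that] .
  \<comment> \<open>The near factors are related at level \<open>Suc m\<close>, which is positive
    and therefore forces equal alphabets.\<close>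
  have alph: "set (near_list d a u) = set (near_list d a v)"
    by (rule factor_eq_SucD(1)[OF near[OF Suc.prems(2)]])
  show ?case
  proof (rule factor_eq_SucI)
    show "set (near_list d a u) = set (near_list d a v)" by (rule alph)
    show "list_eq (\<not> d) (Suc m) n (near_list d a u) (near_list d a v)"
      by (rule factor_eq_antimono[OF near[OF Suc.prems(2)]]) simp
    fix b assume b: "b \<in> set (near_list d a u)"
    note bu = near_list_near_list[OF Suc.prems(2) b]
    note bv = near_list_near_list[OF av b[unfolded alph]]
    show "list_eq (\<not> d) (Suc m) n (near_list d b (near_list d a u)) (near_list d b (near_list d a v))"
      unfolding bu bv by (rule factor_eq_antimono[OF near[OF bu(1)]]) simp
    show "list_eq d (Suc (Suc m)) n (far_list d b (near_list d a u)) (far_list d b (near_list d a v))"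
      unfolding bu bv by (rule Suc.IH[OF far[OF bu(1)] bu(2)])
  qed
qed simp

text \<open>Take the letter with the longest near factor. A letter different from it and missing in
  that factor would first occur beyond it and so have a longer near factor.\<close>

lemma exists_arch:
  assumes "set u \<noteq> {}"
  obtains a where "a \<in> set u" "set (near_list d a u) = set u - {a}"
proof -
  let ?f = "\<lambda>a. length (near_list d a u)"
  have "Max (?f ` set u) \<in> ?f ` set u" using assms by (intro Max_in) auto
  then obtain a where a: "a \<in> set u" and max: "?f a = Max (?f ` set u)" by auto
  obtain x z where u: "u = app d x (app d [a] z)" and x: "a \<notin> set x"
    using list_split[OF a] by blast
  have near: "near_list d a u = x" unfolding u using x by (rule near_list_app)
  have "b \<in> set x" if b: "b \<in> set u" "b \<noteq> a" for b
  proof (rule ccontr)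
    assume bx: "b \<notin> set x"
    then have "b \<in> set z" using b u by simp
    then obtain y y' where z: "z = app d y (app d [b] y')" and y: "b \<notin> set y"
      using list_split[of b z] by blast
    have "u = app d (app d x (app d [a] y)) (app d [b] y')"
      unfolding u z by (simp add: app_assoc)
    then have "near_list d b u = app d x (app d [a] y)"
      using bx b(2) y near_list_app[of b "app d x (app d [a] y)" d y'] by simp
    then have "?f b > ?f a" unfolding near by (simp add: app_def)
    moreover have "?f b \<le> ?f a" unfolding max using b(1) by simp
    ultimately show False by simp
  qed
  then have "set (near_list d a u) = set u - {a}" unfolding near using x u by auto
  with a show ?thesis by (rule that)
qed

subsection \<open>Finite pigeonhole arguments\<close>

text \<open>If every \<open>c\<close> failed at some \<open>N c\<close>, all of them would fail at
  the maximum of these bounds. This fixes data from a finite set for all \<open>n\<close> at once,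
  while the words behind the data change with \<open>n\<close>.\<close>

lemma antitone_pigeonhole:
  fixes P :: "'c \<Rightarrow> nat \<Rightarrow> bool"
  assumes "finite F" and ex: "\<And>n. \<exists>c\<in>F. P c n" and anti: "\<And>c n n'. P c n \<Longrightarrow> n' \<le> n \<Longrightarrow> P c n'"
  shows "\<exists>c\<in>F. \<forall>n. P c n"
proof (rule ccontr)
  assume "\<not> ?thesis"
  then have "\<forall>c\<in>F. \<exists>n. \<not> P c n" by blast
  then obtain N where N: "\<And>c. c \<in> F \<Longrightarrow> \<not> P c (N c)" by metis
  obtain c where c: "c \<in> F" "P c (Max (N ` F))" using ex by blast
  have "N c \<le> Max (N ` F)" using assms(1) c(1) by simp
  then show False using anti[OF c(2)] N[OF c(1)] by blast
qed

text \<open>If \<open>x\<close> never reached \<open>C\<close>, two of the prefix products \<open>g\<close> of its infinite expansion would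
  coincide, which gives \<open>s\<close> with \<open>g s = g\<close>.\<close>

lemma factorization_loop:
  fixes f :: "'n::finite \<Rightarrow> 'n \<Rightarrow> 'n"
  assumes assoc: "\<And>x y z. f (f x y) z = f x (f y z)" and unit: "\<And>x. f e x = x" "\<And>x. f x e = x"
    and step: "\<And>x. T x \<Longrightarrow> C x \<or> (\<exists>p t. D p \<and> T t \<and> x = f p t)"
    and D: "\<And>p q. D p \<Longrightarrow> D q \<Longrightarrow> D (f p q)"
    and C: "\<And>p x. D p \<Longrightarrow> C x \<Longrightarrow> C (f p x)"
    and loop: "\<And>g s t. g = e \<or> D g \<Longrightarrow> D s \<Longrightarrow> f g s = g \<Longrightarrow> T t \<Longrightarrow> C (f g t)"
    and x: "T x"
  shows "C x"
proof (rule ccontr)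
  assume nC: "\<not> C x"
  \<comment> \<open>A state consists of the product \<open>g\<close> of the pieces cut off so far
    and of the remainder \<open>t\<close>, which again avoids \<open>C\<close>.\<close>
  let ?P = "\<lambda>(g, t). T t \<and> \<not> C t \<and> (g = e \<or> D g) \<and> x = f g t"
  let ?Q = "\<lambda>(g, t) (g', t'). \<exists>p. D p \<and> g' = f g p"
  have "\<exists>h. \<forall>n. ?P (h n) \<and> ?Q (h n) (h (Suc n))"
  proof (rule dependent_nat_choice)
    show "\<exists>c. ?P c" using x nC unit by (intro exI[of _ "(e, x)"]) simp
    fix c assume "?P c"
    then obtain g t where c: "c = (g, t)" "T t" "\<not> C t" "g = e \<or> D g" "x = f g t" by blast
    obtain p t' where p: "D p" "T t'" "t = f p t'" using step[OF c(2)] c(3) by blast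
    have "D (f g p)" using c(4) p(1) D[of g p] unit(1)[of p] by auto
    moreover have "\<not> C t'" using C[OF p(1)] c(3) p(3) by blast
    moreover have "x = f (f g p) t'" using c(5) p(3) assoc by simp
    ultimately have "?P (f g p, t') \<and> ?Q c (f g p, t')" using p c(1) by auto
    then show "\<exists>c'. ?P c' \<and> ?Q c c'" by blast
  qed
  then obtain h where "\<forall>n. ?P (h n) \<and> ?Q (h n) (h (Suc n))" ..
  then have h: "?P (h n)" "?Q (h n) (h (Suc n))" for n by simp_all
  define G where "G n = fst (h n)" for n
  have hG: "T (snd (h n))" "\<not> C (snd (h n))" "G n = e \<or> D (G n)" "x = f (G n) (snd (h n))" for n
    using h(1)[of n] by (auto simp: G_def split: prod.splits)
  have G: "\<exists>p. D p \<and> G (Suc n) = f (G n) p" for n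
    using h(2)[of n] by (auto simp: G_def split: prod.splits)
  \<comment> \<open>The successor ensures that at least one piece lies between the two prefixes, so
    that \<open>D s\<close> holds.\<close>
  have prod: "\<exists>s. D s \<and> G (Suc (i + k)) = f (G i) s" for i k
  proof (induction k)
    case (Suc k)
    then obtain s p where "D s" "G (Suc (i + k)) = f (G i) s" "D p" "G (Suc (Suc (i + k))) = f (G (Suc (i + k))) p"
      using G[of "Suc (i + k)"] by blast
    then show ?case using D[of s p] by (auto simp: assoc)
  qed (use G in simp)
  have "\<not> inj G" using finite_imageD[of G UNIV] infinite_UNIV_nat by auto
  then obtain i j where "i < j" "G i = G j" unfolding inj_def by (metis nat_neq_iff)
  then obtain s where "D s" "f (G i) s = G i" using prod[of i "j - Suc i"] by auto
  then show False using loop[of "G i" s "snd (h i)"] hG[of i] nC by simp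
qed

subsection \<open>Scattered subwords\<close>

text \<open>The finite scattered subwords of the word over \<open>omega_omega_star\<close>. A power
  has infinitely many copies and each letter of a list can use a copy of its own, so every list over
  the alphabet embeds.\<close>

primrec subwords :: "'a pterm \<Rightarrow> 'a list set" where
  "subwords Eps = {[]}"
| "subwords (Letter a) = {[], [a]}"
| "subwords (Cat \<alpha> \<beta>) = {s @ t | s t. s \<in> subwords \<alpha> \<and> t \<in> subwords \<beta>}"
| "subwords (Pi \<alpha>) = lists (set_pterm \<alpha>)"

lemma Nil_in_subwords [simp]: "[] \<in> subwords \<alpha>"
  by (induction \<alpha>) auto

lemma subwords_subset: "subwords \<alpha> \<subseteq> lists (set_pterm \<alpha>)"
proof (induction \<alpha>)
  case (Cat \<alpha> \<beta>)
  then show ?case by (auto dest!: subsetD)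
qed auto

lemma subseq_rev_iff: "subseq (rev s) (rev t) \<longleftrightarrow> subseq s t"
proof -
  have "subseq s t \<Longrightarrow> subseq (rev s) (rev t)" for s t :: "'a list"
    by (induction rule: list_emb.induct) (auto intro: list_emb_append_mono subseq_rev_drop_many)
  from this[of s t] this[of "rev s" "rev t"] show ?thesis by auto
qed

lemma subseq_imp_subset: "subseq s t \<Longrightarrow> set s \<subseteq> set t"
  by (induction rule: list_emb.induct) auto

lemma subseq_subwords: "t \<in> subwords \<alpha> \<Longrightarrow> subseq s t \<Longrightarrow> s \<in> subwords \<alpha>"
proof (induction \<alpha> arbitrary: s t)
  case (Letter a)
  then show ?case by (cases s) (auto split: if_splits)
next
  case (Cat \<alpha> \<beta>)
  then obtain x y where xy: "t = x @ y" "x \<in> subwords \<alpha>" "y \<in> subwords \<beta>" by auto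
  then obtain s1 s2 where "s = s1 @ s2" "subseq s1 x" "subseq s2 y"
    using Cat.prems(2) by (auto elim: subseq_appendE)
  then show ?case using Cat.IH(1)[OF xy(2)] Cat.IH(2)[OF xy(3)] by auto
next
  case (Pi \<alpha>)
  then show ?case using subseq_imp_subset[of s t] by auto
qed auto

lemma subwords_cat: "subwords (cat d \<alpha> \<beta>) = {app d s t | s t. s \<in> subwords \<alpha> \<and> t \<in> subwords \<beta>}"
  by (auto simp: cat_def app_def)

lemma app_singleton_eq_app:
  "app d [a] t = app d x y \<longleftrightarrow> x = [] \<and> y = app d [a] t \<or> (\<exists>z. x = app d [a] z \<and> t = app d z y)"
proof (cases d)
  case False
  have "t @ [a] = y @ x \<longleftrightarrow> x = [] \<and> y = t @ [a] \<or> (\<exists>z. x = z @ [a] \<and> t = y @ z)"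
    by (cases x rule: rev_cases) auto
  then show ?thesis using False by (simp add: app_def)
qed (auto simp: app_def Cons_eq_append_conv)

lemma set_pterm_far: "set_pterm (far d a \<alpha>) \<subseteq> set_pterm \<alpha>"
  by (induction \<alpha>) auto

lemma subseq_app: "subseq t (app d x t)" "subseq t (app d t x)"
  by (auto simp: app_def)

text \<open>Greedy embedding: placing \<open>a\<close> at its nearest occurrence leaves the most
  room for \<open>t\<close>. In a power the far factor contains the whole power again and hence
  every list over the alphabet.\<close>

lemma subwords_far:
  "app d [a] t \<in> subwords \<alpha> \<longleftrightarrow> a \<in> set_pterm \<alpha> \<and> t \<in> subwords (far d a \<alpha>)"
proof (induction \<alpha> arbitrary: t)
  case (Letter b)
  show ?case by (auto simp: app_def)
next
  case (Cat \<alpha>1 \<alpha>2)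
  obtain \<beta> \<gamma> where c: "Cat \<alpha>1 \<alpha>2 = cat d \<beta> \<gamma>" and
    IH: "\<And>t. app d [a] t \<in> subwords \<beta> \<longleftrightarrow> a \<in> set_pterm \<beta> \<and> t \<in> subwords (far d a \<beta>)"
     "\<And>t. app d [a] t \<in> subwords \<gamma> \<longleftrightarrow> a \<in> set_pterm \<gamma> \<and> t \<in> subwords (far d a \<gamma>)"
    using Cat.IH Cat_eq_cat[of \<alpha>1 \<alpha>2 d] by (cases d) auto
  have "app d [a] t \<in> subwords (cat d \<beta> \<gamma>) \<longleftrightarrow>
      app d [a] t \<in> subwords \<gamma> \<or> (\<exists>z y. app d [a] z \<in> subwords \<beta> \<and> y \<in> subwords \<gamma> \<and> t = app d z y)"
  proof
    assume "app d [a] t \<in> subwords \<gamma> \<or> (\<exists>z y. app d [a] z \<in> subwords \<beta> \<and> y \<in> subwords \<gamma> \<and> t = app d z y)"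
    then show "app d [a] t \<in> subwords (cat d \<beta> \<gamma>)"
    proof
      assume "app d [a] t \<in> subwords \<gamma>"
      then show ?thesis
        unfolding subwords_cat by (intro CollectI exI[of _ "[]"] exI[of _ "app d [a] t"]) simp
    next
      assume "\<exists>z y. app d [a] z \<in> subwords \<beta> \<and> y \<in> subwords \<gamma> \<and> t = app d z y"
      then obtain z y where z: "app d [a] z \<in> subwords \<beta>" "y \<in> subwords \<gamma>" "t = app d z y" by blast
      then have "app d [a] t = app d (app d [a] z) y" by (simp add: app_assoc)
      with z show ?thesis unfolding subwords_cat by blast
    qed
  qed (auto simp: subwords_cat app_singleton_eq_app)
  moreover have "t \<in> subwords \<gamma>" if "app d [a] t \<in> subwords \<gamma>"
    using subseq_subwords[OF that subseq_app(1)] .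
  moreover have "t \<in> subwords (cat d (far d a \<beta>) \<gamma>) \<longleftrightarrow>
      (\<exists>z y. z \<in> subwords (far d a \<beta>) \<and> y \<in> subwords \<gamma> \<and> t = app d z y)"
    unfolding subwords_cat by blast
  moreover have "\<exists>z y. z \<in> subwords (far d a \<beta>) \<and> y \<in> subwords \<gamma> \<and> t = app d z y" if "t \<in> subwords \<gamma>"
    by (intro exI[of _ "[]"] exI[of _ t]) (simp add: that)
  ultimately show ?case
    unfolding c far_cat IH by (cases "a \<in> set_pterm \<beta>") (simp_all only: set_pterm_cat Un_iff if_True if_False simp_thms, metis+)
next
  case (Pi \<alpha>)
  have "subwords (far d a (Pi \<alpha>)) = lists (set_pterm \<alpha>)"
  proof
    have "set_pterm (far d a (Pi \<alpha>)) \<subseteq> set_pterm \<alpha>"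
      using set_pterm_far[of d a "Pi \<alpha>"] by simp
    from lists_mono[OF this] show "subwords (far d a (Pi \<alpha>)) \<subseteq> lists (set_pterm \<alpha>)"
      by (rule subset_trans[OF subwords_subset])
    show "lists (set_pterm \<alpha>) \<subseteq> subwords (far d a (Pi \<alpha>))"
    proof
      fix s assume "s \<in> lists (set_pterm \<alpha>)"
      then show "s \<in> subwords (far d a (Pi \<alpha>))"
        by (simp only: far.simps subwords_cat subwords.simps)
          (intro CollectI exI[of _ "[]"] exI[of _ s], simp)
    qed
  qed
  then show ?case by (auto simp: app_def)
qed (simp add: app_def)

text \<open>At level 1 the clauses with turned direction are at level 0 and hold trivially. What
  remains are the alphabet and the far factors, and by \<open>subwords_far\<close> the set of
  subwords determines both.\<close>

lemma term_eq_1: "subwords \<alpha> = subwords \<beta> \<Longrightarrow> term_eq d (Suc 0) n \<alpha> \<beta>"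
proof (induction n arbitrary: \<alpha> \<beta>)
  case (Suc n)
  have 1: "a \<in> set_pterm \<alpha> \<longleftrightarrow> app d [a] [] \<in> subwords \<alpha>" for a and \<alpha> :: "'a pterm"
    unfolding subwords_far by simp
  have alph: "set_pterm \<alpha> = set_pterm \<beta>"
    unfolding set_eq_iff 1 Suc.prems by simp
  have "subwords (far d a \<alpha>) = subwords (far d a \<beta>)" if "a \<in> set_pterm \<alpha>" for a
  proof (rule set_eqI)
    fix t
    show "t \<in> subwords (far d a \<alpha>) \<longleftrightarrow> t \<in> subwords (far d a \<beta>)"
      using subwords_far[of d a t \<alpha>] subwords_far[of d a t \<beta>] that alph Suc.prems by simp
  qed
  then show ?case using Suc.IH alph by simp
qed simp

lemma subseq_Cons_append_not_in: "a \<notin> set x \<Longrightarrow> subseq (a # t) (x @ y) \<longleftrightarrow> subseq (a # t) y"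
  by (induction x) auto

text \<open>The list counterpart of \<open>subwords_far\<close>; reading from the right is reduced
  to reading from the left by reversal.\<close>

lemma subseq_far_list:
  "subseq (app d [a] t) u \<longleftrightarrow> a \<in> set u \<and> subseq t (far_list d a u)"
proof (cases "a \<in> set u")
  case True
  then obtain x y where u: "u = app d x (app d [a] y)" and x: "a \<notin> set x"
    using list_split[OF True] by blast
  have far: "far_list d a u = y" unfolding u using x by (rule far_list_app)
  have *: "subseq (a # t) (x @ a # y) \<longleftrightarrow> subseq t y" if "a \<notin> set x" for x y t
    unfolding subseq_Cons_append_not_in[OF that] by simp
  have "subseq (app d [a] t) u \<longleftrightarrow> subseq t y"
  proof (cases d)
    case True
    then show ?thesis using *[OF x] unfolding u by (simp add: app_def)
  next
    case False
    have "subseq (t @ [a]) (y @ a # x) \<longleftrightarrow> subseq (a # rev t) (rev x @ a # rev y)"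
      by (subst subseq_rev_iff[symmetric]) simp
    also have "\<dots> \<longleftrightarrow> subseq t y"
      unfolding subseq_rev_iff[of t y, symmetric] by (rule *) (simp add: x)
    finally show ?thesis using False unfolding u by (simp add: app_def)
  qed
  then show ?thesis using True by (simp add: far)
next
  case False
  then have "\<not> set (app d [a] t) \<subseteq> set u" by simp
  then have "\<not> subseq (app d [a] t) u" using subseq_imp_subset by blast
  then show ?thesis using False by simp
qed

text \<open>Embed \<open>t\<close> greedily from side \<open>d\<close>. Each letter passes to a far
  factor and costs one step of \<open>n\<close>.\<close>

lemma list_eq_1: "list_eq d (Suc 0) n u v \<Longrightarrow> length t \<le> n \<Longrightarrow> subseq t u \<longleftrightarrow> subseq t v"
proof (induction n arbitrary: t u v)
  case (Suc n)
  show ?case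
  proof (cases "t = []")
    case False
    obtain a s where t: "t = app d [a] s"
    proof (cases d)
      case True
      then show ?thesis using that \<open>t \<noteq> []\<close> by (cases t) (auto simp: app_def)
    next
      case False
      then show ?thesis using that \<open>t \<noteq> []\<close> by (cases t rule: rev_cases) (auto simp: app_def)
    qed
    then have len: "length s \<le> n" using Suc.prems(2) by (simp add: app_def split: if_splits)
    have "subseq s (far_list d a u) \<longleftrightarrow> subseq s (far_list d a v)" if "a \<in> set u"
      using Suc.IH[OF factor_eq_SucD(4)[OF Suc.prems(1) that], of s] len by simp
    then show ?thesis
      unfolding t subseq_far_list using factor_eq_SucD(1)[OF Suc.prems(1)] by blast
  qed simp
qed simp

text \<open>Pointwise convergence of subword sets: each fixed \<open>t\<close> is misjudged at
  finitely many indices of \<open>J\<close> only. On an infinite \<open>J\<close> the limit set is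
  thereby unique.\<close>

definition converges_to :: "nat set \<Rightarrow> (nat \<Rightarrow> 'a list) \<Rightarrow> 'a pterm \<Rightarrow> bool" where
  "converges_to J u \<alpha> \<longleftrightarrow> (\<forall>t. finite {n\<in>J. subseq t (u n) \<noteq> (t \<in> subwords \<alpha>)})"

lemma converges_to_subset:
  assumes "converges_to J u \<alpha>" "K \<subseteq> J"
  shows "converges_to K u \<alpha>"
  unfolding converges_to_def
proof
  fix t
  show "finite {n\<in>K. subseq t (u n) \<noteq> (t \<in> subwords \<alpha>)}"
  proof (rule finite_subset)
    show "finite {n\<in>J. subseq t (u n) \<noteq> (t \<in> subwords \<alpha>)}"
      using assms(1) unfolding converges_to_def by blast
  qed (use assms(2) in blast)
qed

lemma subseq_append_right_iff: "subseq t (x @ y) \<longleftrightarrow> (\<exists>i\<le>length t. subseq (take i t) x \<and> subseq (drop i t) y)"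
proof
  assume "subseq t (x @ y)"
  then obtain s s' where "t = s @ s'" "subseq s x" "subseq s' y" by (rule subseq_appendE)
  then show "\<exists>i\<le>length t. subseq (take i t) x \<and> subseq (drop i t) y"
    by (intro exI[of _ "length s"]) simp
next
  assume "\<exists>i\<le>length t. subseq (take i t) x \<and> subseq (drop i t) y"
  then obtain i where "subseq (take i t) x" "subseq (drop i t) y" by blast
  from list_emb_append_mono[OF this] show "subseq t (x @ y)" by simp
qed

text \<open>A list \<open>t\<close> has finitely many splittings, so the exceptional indices for
  \<open>t\<close> are covered by finitely many finite sets, those for its prefixes and
  suffixes.\<close>

lemma converges_to_Cat:
  assumes "converges_to J u \<alpha>" "converges_to J v \<beta>"
  shows "converges_to J (\<lambda>n. u n @ v n) (Cat \<alpha> \<beta>)"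
  unfolding converges_to_def
proof
  fix t
  have sub: "t \<in> subwords (Cat \<alpha> \<beta>) \<longleftrightarrow> (\<exists>i\<le>length t. take i t \<in> subwords \<alpha> \<and> drop i t \<in> subwords \<beta>)"
  proof
    assume "t \<in> subwords (Cat \<alpha> \<beta>)"
    then obtain s s' where "t = s @ s'" "s \<in> subwords \<alpha>" "s' \<in> subwords \<beta>" by auto
    then show "\<exists>i\<le>length t. take i t \<in> subwords \<alpha> \<and> drop i t \<in> subwords \<beta>"
      by (intro exI[of _ "length s"]) simp
  next
    assume "\<exists>i\<le>length t. take i t \<in> subwords \<alpha> \<and> drop i t \<in> subwords \<beta>"
    then obtain i where "take i t \<in> subwords \<alpha>" "drop i t \<in> subwords \<beta>" by blast
    then show "t \<in> subwords (Cat \<alpha> \<beta>)"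
      by (simp only: subwords.simps) (intro CollectI exI[of _ "take i t"] exI[of _ "drop i t"], simp)
  qed
  have "{n\<in>J. subseq t (u n @ v n) \<noteq> (t \<in> subwords (Cat \<alpha> \<beta>))} \<subseteq>
      (\<Union>i\<le>length t. {n\<in>J. subseq (take i t) (u n) \<noteq> (take i t \<in> subwords \<alpha>)} \<union>
        {n\<in>J. subseq (drop i t) (v n) \<noteq> (drop i t \<in> subwords \<beta>)})"
  proof
    fix n assume "n \<in> {n\<in>J. subseq t (u n @ v n) \<noteq> (t \<in> subwords (Cat \<alpha> \<beta>))}"
    then have "n \<in> J" and "\<exists>i\<le>length t. (subseq (take i t) (u n) \<and> subseq (drop i t) (v n)) \<noteq>
        (take i t \<in> subwords \<alpha> \<and> drop i t \<in> subwords \<beta>)"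
      unfolding sub subseq_append_right_iff by auto
    then show "n \<in> (\<Union>i\<le>length t. {n\<in>J. subseq (take i t) (u n) \<noteq> (take i t \<in> subwords \<alpha>)} \<union>
        {n\<in>J. subseq (drop i t) (v n) \<noteq> (drop i t \<in> subwords \<beta>)})"
      by auto
  qed
  moreover have "finite \<dots>"
    using assms by (intro finite_UN_I finite_UnI) (simp_all add: converges_to_def)
  ultimately show "finite {n\<in>J. subseq t (u n @ v n) \<noteq> (t \<in> subwords (Cat \<alpha> \<beta>))}"
    by (rule finite_subset)
qed

lemma converges_to_Letter: "converges_to J (\<lambda>n. [a]) (Letter a)"
proof -
  have "subseq t [a] \<longleftrightarrow> t \<in> subwords (Letter a)" for t
    by (cases t) (auto split: if_splits)
  then show ?thesis by (simp add: converges_to_def)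
qed

section \<open>Finite words denoted by terms\<close>

primrec term_list :: "nat \<Rightarrow> 'a pterm \<Rightarrow> 'a list" where
  "term_list k Eps = []"
| "term_list k (Letter a) = [a]"
| "term_list k (Cat \<alpha> \<beta>) = term_list k \<alpha> @ term_list k \<beta>"
| "term_list k (Pi \<alpha>) = concat (replicate k (term_list k \<alpha>))"

lemma set_term_list: "set (term_list k \<alpha>) \<subseteq> set_pterm \<alpha>"
  by (induction \<alpha>) auto

lemma term_list_word_term [simp]: "term_list k (word_term xs) = xs"
  by (induction xs) simp_all

lemma word_iso_word_of_list_replicate:
  assumes "word_iso (word_of_list xs) w" "Linear_order (le w)"
  shows "word_iso (word_of_list (concat (replicate k xs))) (wpower w (fin_order k))"
proof (induction k)
  case 0
  have "wdom (wpower w (fin_order 0)) = {}"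
    by (simp add: wdom_wpower[OF assms(2) Linear_order_fin_order])
  then show ?case by (intro word_isoI[of "\<lambda>_. undefined"]) (simp_all add: bij_betw_def)
next
  case (Suc k)
  have "word_iso (word_of_list (concat (replicate (Suc k) xs))) (wconcat w (wpower w (fin_order k)))"
    using word_iso_word_of_list_append[OF assms(1) Suc] by simp
  then show ?case
    by (rule word_iso_trans[OF _ word_iso_sym[OF word_iso_wpower_fin_order_Suc[OF assms(2)]]])
qed

text \<open>Replaces the description by isomorphism with a recursion on the term; finite powers are
  treated by splitting off one copy at a time.\<close>

lemma list_of_word_interp: "list_of_word (interp (fin_order k) \<alpha>) = term_list k \<alpha>"
proof (rule list_of_word_eqI, induction \<alpha>)
  case Eps
  show ?case using word_iso_word_term[of "[]" "fin_order k"] by simp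
next
  case (Letter a)
  show ?case using word_iso_singleton by simp
next
  case (Cat \<alpha> \<beta>)
  then show ?case using word_iso_word_of_list_append by simp
next
  case (Pi \<alpha>)
  then show ?case
    using word_iso_word_of_list_replicate[OF Pi Linear_order_interp[OF Linear_order_fin_order]] by simp
qed

subsection \<open>Values of terms\<close>

lemma power_absorb_right: "x * y = x \<Longrightarrow> x * y ^ k = (x :: 'm::monoid_mult)"
  by (induction k) (simp_all add: mult.assoc[symmetric])

lemma power_absorb_left: "y * x = x \<Longrightarrow> y ^ k * x = (x :: 'm::monoid_mult)"
  by (induction k) (simp_all add: mult.assoc)

lemma converges_to_cong:
  assumes "\<And>n. n \<in> J \<Longrightarrow> u n = v n" "converges_to J u \<alpha>"
  shows "converges_to J v \<alpha>"
proof -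
  have "{n\<in>J. subseq t (u n) \<noteq> (t \<in> subwords \<alpha>)} = {n\<in>J. subseq t (v n) \<noteq> (t \<in> subwords \<alpha>)}" for t
    using assms(1) by auto
  then show ?thesis using assms(2) by (simp only: converges_to_def simp_thms)
qed

locale word_hom =
  fixes \<Sigma> :: "'a set" and \<phi> :: "'a list \<Rightarrow> 'm::{finite, monoid_mult}" and k :: nat
  assumes finite_alphabet: "finite \<Sigma>" and hom_Nil: "\<phi> [] = 1"
    and hom_append: "\<And>x y. x \<in> lists \<Sigma> \<Longrightarrow> y \<in> lists \<Sigma> \<Longrightarrow> \<phi> (x @ y) = \<phi> x * \<phi> y"
begin

definition val :: "'a pterm \<Rightarrow> 'm" where
  "val \<alpha> = \<phi> (term_list k \<alpha>)"

definition mul :: "bool \<Rightarrow> 'm \<Rightarrow> 'm \<Rightarrow> 'm" where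
  "mul d x y = (if d then x * y else y * x)"

lemma term_list_lists: "set_pterm \<alpha> \<subseteq> \<Sigma> \<Longrightarrow> term_list k \<alpha> \<in> lists \<Sigma>"
  using set_term_list[of k \<alpha>] by auto

lemma hom_app: "set x \<subseteq> \<Sigma> \<Longrightarrow> set y \<subseteq> \<Sigma> \<Longrightarrow> \<phi> (app d x y) = mul d (\<phi> x) (\<phi> y)"
  by (auto simp: app_def mul_def hom_append in_lists_conv_set subset_iff)

lemma val_word_term [simp]: "val (word_term x) = \<phi> x"
  by (simp add: val_def)

lemma val_Eps [simp]: "val Eps = 1"
  by (simp add: val_def hom_Nil)

lemma val_Letter [simp]: "val (Letter a) = \<phi> [a]"
  by (simp add: val_def)

lemma val_Cat: "set_pterm \<alpha> \<subseteq> \<Sigma> \<Longrightarrow> set_pterm \<beta> \<subseteq> \<Sigma> \<Longrightarrow> val (Cat \<alpha> \<beta>) = val \<alpha> * val \<beta>"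
  by (simp add: val_def hom_append term_list_lists)

lemma val_cat: "set_pterm \<alpha> \<subseteq> \<Sigma> \<Longrightarrow> set_pterm \<beta> \<subseteq> \<Sigma> \<Longrightarrow> val (cat d \<alpha> \<beta>) = mul d (val \<alpha>) (val \<beta>)"
  by (simp add: cat_def mul_def val_Cat)

lemma val_Pi:
  assumes "set_pterm \<alpha> \<subseteq> \<Sigma>"
  shows "val (Pi \<alpha>) = val \<alpha> ^ k"
proof -
  have "concat (replicate j (term_list k \<alpha>)) \<in> lists \<Sigma>" for j
    using term_list_lists[OF assms] by (induction j) auto
  then have "\<phi> (concat (replicate j (term_list k \<alpha>))) = val \<alpha> ^ j" for j
    using term_list_lists[OF assms] by (induction j) (simp_all add: hom_Nil hom_append val_def)
  then show ?thesis by (simp add: val_def)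
qed

lemma mul_assoc: "mul d (mul d x y) z = mul d x (mul d y z)"
  by (simp add: mul_def mult.assoc)

lemma mul_1 [simp]: "mul d 1 x = x" "mul d x 1 = x"
  by (simp_all add: mul_def)

text \<open>This is how a power enters a term without changing its value: it is placed after a
  prefix of value \<open>g\<close> that absorbs the value \<open>s\<close> of its base.\<close>

lemma mul_power_absorb: "mul d g s = g \<Longrightarrow> mul d g (s ^ j) = g"
  by (auto simp: mul_def power_absorb_right power_absorb_left split: if_splits)

subsection \<open>The first level\<close>

text \<open>Known as universality of order \<open>j\<close>. For nonempty \<open>B\<close> and lists
  over \<open>B\<close> it means that at least \<open>j\<close> consecutive arches can be cut
  off.\<close>

definition rich :: "'a set \<Rightarrow> nat \<Rightarrow> 'a list \<Rightarrow> bool" where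
  "rich B j u \<longleftrightarrow> (\<forall>t\<in>lists B. length t = j \<longrightarrow> subseq t u)"

text \<open>An arch contains all letters of \<open>B\<close>, so the first letter of a list finds
  its place there and the others in the far factor. It is applied in the contrapositive: cutting an
  arch off a poor list leaves a poorer one.\<close>

lemma rich_SucI:
  assumes "set (near_list True a u) = B - {a}" "a \<in> set u" "rich B j (far_list True a u)"
  shows "rich B (Suc j) u"
  unfolding rich_def
proof (intro ballI impI)
  fix t assume t: "t \<in> lists B" "length t = Suc j"
  then obtain b s where bs: "t = b # s" "b \<in> B" "s \<in> lists B" "length s = j" by (cases t) auto
  let ?x = "near_list True a u" and ?y = "far_list True a u"
  have u: "u = (?x @ [a]) @ ?y" using list_eq_near_far(1)[OF assms(2), of True] by (simp add: app_def)
  have "b \<in> set (?x @ [a])" using bs(2) assms(1) by auto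
  then have "subseq [b] (?x @ [a])" using subseq_singleton_left by metis
  moreover have "subseq s ?y" using assms(3) bs unfolding rich_def by blast
  ultimately have "subseq ([b] @ s) ((?x @ [a]) @ ?y)" by (rule list_emb_append_mono)
  then show "subseq t u" using bs(1) u by simp
qed

lemma rich_far_list:
  assumes "rich B (Suc j) u" "a \<in> B"
  shows "rich B j (far_list d a u)"
  unfolding rich_def
proof (intro ballI impI)
  fix t assume "t \<in> lists B" "length t = j"
  then have "subseq (app d [a] t) u"
    using assms unfolding rich_def by (auto simp: app_def)
  then show "subseq t (far_list d a u)" by (simp add: subseq_far_list)
qed

lemma rich_Suc_subset:
  assumes "rich B (Suc j) u"
  shows "B \<subseteq> set u"
proof
  fix a assume "a \<in> B"
  then have "app True [a] (replicate j a) \<in> lists B" "length (app True [a] (replicate j a)) = Suc j"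
    by (simp_all add: app_def in_lists_conv_set)
  then have "subseq (app True [a] (replicate j a)) u"
    using assms unfolding rich_def by blast
  then show "a \<in> set u" by (simp only: subseq_far_list)
qed

lemma rich_antimono:
  assumes "rich B j u" "i \<le> j"
  shows "rich B i u"
  unfolding rich_def
proof (intro ballI impI)
  fix t assume t: "t \<in> lists B" "length t = i"
  show "subseq t u"
  proof (cases "B = {}")
    case False
    then obtain b where "b \<in> B" by blast
    then have "t @ replicate (j - i) b \<in> lists B" "length (t @ replicate (j - i) b) = j"
      using t assms(2) by auto
    then have "subseq (t @ replicate (j - i) b) u" using assms(1) unfolding rich_def by blast
    moreover have "subseq t (t @ replicate (j - i) b)" by (simp add: subseq_rev_drop_many)
    ultimately show ?thesis by (rule subseq_order.order_trans[rotated])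
  qed (use t in simp)
qed

text \<open>An application of \<open>factorization_loop\<close>. \<open>D\<close> holds the values
  of lists with full alphabet, such as arches, \<open>T\<close> those attained by lists of every
  richness, and \<open>C\<close> those of the terms sought. A rich list can always lose another
  arch.\<close>

lemma rich_term:
  assumes B: "B \<subseteq> \<Sigma>" and x: "\<And>j. \<exists>u\<in>lists B. rich B j u \<and> \<phi> u = x"
  shows "\<exists>\<alpha>. set_pterm \<alpha> \<subseteq> B \<and> subwords \<alpha> = lists B \<and> val \<alpha> = x"
proof -
  let ?T = "\<lambda>x. \<forall>j. \<exists>u\<in>lists B. rich B j u \<and> \<phi> u = x"
  let ?C = "\<lambda>x. \<exists>\<alpha>. set_pterm \<alpha> \<subseteq> B \<and> subwords \<alpha> = lists B \<and> val \<alpha> = x"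
  let ?D = "\<lambda>x. \<exists>u. set u = B \<and> \<phi> u = x"
  have finB: "finite B" using finite_subset[OF B finite_alphabet] .
  have sub: "subwords \<alpha> \<subseteq> lists B" if "set_pterm \<alpha> \<subseteq> B" for \<alpha>
    using subwords_subset lists_mono[OF that] by (rule subset_trans)
  have "?C x"
  proof (rule factorization_loop[where T = ?T and C = ?C and D = ?D and f = "(*)" and e = 1])
    fix x assume T: "?T x"
    show "?C x \<or> (\<exists>p t. ?D p \<and> ?T t \<and> x = p * t)"
    proof (cases "B = {}")
      case True
      then have "x = 1" using T hom_Nil by (auto dest: spec[of _ 0])
      then have "?C x" using True by (intro exI[of _ Eps]) simp
      then show ?thesis ..
    next
      case False
      \<comment> \<open>The value \<open>p\<close> of the arch and the value \<open>t\<close> of the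
        rest depend on the list and hence on \<open>j\<close>; the pigeonhole over pairs of values
        makes them uniform.\<close>
      let ?P = "\<lambda>(p, t) j. ?D p \<and> x = p * t \<and> (\<exists>u\<in>lists B. rich B j u \<and> \<phi> u = t)"
      have "\<exists>c\<in>UNIV. ?P c j" for j
      proof -
        obtain u where u: "u \<in> lists B" "rich B (Suc j) u" "\<phi> u = x" using T by blast
        have su: "set u = B" using rich_Suc_subset[OF u(2)] u(1) by auto
        obtain a where a: "a \<in> set u" "set (near_list True a u) = set u - {a}"
          using exists_arch[of u True] su False by metis
        let ?x = "near_list True a u" and ?y = "far_list True a u"
        have eq: "u = (?x @ [a]) @ ?y"
          using list_eq_near_far(1)[OF a(1), of True] by (simp add: app_def)
        have sx: "set (?x @ [a]) = B" using a su by auto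
        have "set (?x @ [a]) \<subseteq> B" "set ?y \<subseteq> B" using arg_cong[OF eq, of set] su by auto
        then have l: "?x @ [a] \<in> lists \<Sigma>" "?y \<in> lists \<Sigma>" "?y \<in> lists B"
          using B by (auto simp only: in_lists_conv_set)
        have "x = \<phi> (?x @ [a]) * \<phi> ?y"
          using hom_append[OF l(1,2)] eq u(3) by simp
        moreover have "rich B j ?y" using rich_far_list[OF u(2)] a(1) su by simp
        ultimately have "?P (\<phi> (?x @ [a]), \<phi> ?y) j" using sx l(3) by blast
        then show ?thesis by blast
      qed
      then have "\<exists>c\<in>UNIV. \<forall>j. ?P c j"
      proof (rule antitone_pigeonhole[rotated])
        show "?P c i" if "?P c j" "i \<le> j" for c i j
        proof -
          obtain p t where c: "c = (p, t)" by (cases c)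
          have "rich B j u \<Longrightarrow> rich B i u" for u using that(2) by (rule rich_antimono[rotated])
          then show ?thesis using that(1) unfolding c prod.case by blast
        qed
      qed simp
      then obtain c where c: "\<And>j. ?P c j" by blast
      obtain p t where "c = (p, t)" by (cases c)
      then have "?D p" "x = p * t" "?T t" using c by auto
      then show ?thesis by blast
    qed
  next
    fix p q assume "?D p" "?D q"
    then obtain u v where uv: "set u = B" "set v = B" "\<phi> u = p" "\<phi> v = q" by blast
    then have "\<phi> (u @ v) = p * q" using hom_append[of u v] B by auto
    then show "?D (p * q)" using uv by (intro exI[of _ "u @ v"]) simp
  next
    fix p x assume "?D p" "?C x"
    then obtain u \<alpha> where u: "set u = B" "\<phi> u = p" and \<alpha>: "set_pterm \<alpha> \<subseteq> B" "subwords \<alpha> = lists B" "val \<alpha> = x"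
      by blast
    let ?\<beta> = "Cat (word_term u) \<alpha>"
    have setB: "set_pterm ?\<beta> \<subseteq> B" using u \<alpha> by simp
    moreover have "lists B \<subseteq> subwords ?\<beta>"
    proof
      fix t assume "t \<in> lists B"
      then show "t \<in> subwords ?\<beta>"
        unfolding subwords.simps by (intro CollectI exI[of _ "[]"] exI[of _ t]) (simp add: \<alpha>(2))
    qed
    moreover have "val ?\<beta> = p * x" using u \<alpha> B by (subst val_Cat) auto
    ultimately show "?C (p * x)" using sub[OF setB] by (intro exI[of _ ?\<beta>] conjI equalityI)
  next
    fix g s t assume "g = 1 \<or> ?D g" "?D s" and gs: "g * s = g" and "?T t"
    then obtain v w where v: "set v = B" "\<phi> v = s" and w: "w \<in> lists B" "\<phi> w = t" by blast
    obtain u where u: "set u \<subseteq> B" "\<phi> u = g"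
      using \<open>g = 1 \<or> ?D g\<close> hom_Nil by (metis empty_set empty_subsetI order_refl)
    \<comment> \<open>The power alone supplies all of \<open>lists B\<close>, and since
      \<open>g\<close> absorbs \<open>s\<close> it does not affect the value
      \<open>g * t\<close>.\<close>
    let ?\<beta> = "Cat (Cat (word_term u) (Pi (word_term v))) (word_term w)"
    have setB: "set_pterm ?\<beta> \<subseteq> B" using u v w by auto
    moreover have "lists B \<subseteq> subwords ?\<beta>"
    proof
      fix t assume "t \<in> lists B"
      then have "t \<in> subwords (Cat (word_term u) (Pi (word_term v)))"
        unfolding subwords.simps by (intro CollectI exI[of _ "[]"] exI[of _ t]) (simp add: v)
      then show "t \<in> subwords ?\<beta>"
        unfolding subwords.simps(3)[of "Cat _ _"] by (intro CollectI exI[of _ t] exI[of _ "[]"]) simp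
    qed
    moreover have "val ?\<beta> = g * t"
    proof -
      have \<Sigma>: "set u \<subseteq> \<Sigma>" "set v \<subseteq> \<Sigma>" "set w \<subseteq> \<Sigma>" using u v w B by auto
      then have "val ?\<beta> = (val (word_term u) * val (word_term v) ^ k) * val (word_term w)"
        by (simp only: val_Cat val_Pi pterm.set set_word_term Un_least)
      then show ?thesis using u v w power_absorb_right[OF gs] by simp
    qed
    ultimately show "?C (g * t)" using sub[OF setB] by (intro exI[of _ ?\<beta>] conjI equalityI)
  qed (use x in \<open>simp_all add: mult.assoc\<close>)
  then show ?thesis .
qed

text \<open>A compactness statement, by induction on the alphabet. Either infinitely many lists fail
  a fixed richness \<open>j\<close>, and then they are cut into boundedly many pieces over smaller
  alphabets and single letters; or almost all lists have any given richness, and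
  \<open>rich_term\<close> gives a term that has all of \<open>lists B\<close> as subwords.\<close>

lemma converging_subsequence:
  assumes "finite B" "B \<subseteq> \<Sigma>" "infinite I" "\<forall>n\<in>I. u n \<in> lists B"
  shows "\<exists>J \<alpha>. J \<subseteq> I \<and> infinite J \<and> set_pterm \<alpha> \<subseteq> B \<and> (\<forall>n\<in>J. \<phi> (u n) = val \<alpha>) \<and>
    converges_to J u \<alpha>"
  using assms
proof (induction B arbitrary: u I rule: finite_psubset_induct)
  case (psubset B)
  let ?goal = "\<lambda>u I. \<exists>J \<alpha>. J \<subseteq> I \<and> infinite J \<and> set_pterm \<alpha> \<subseteq> B \<and> (\<forall>n\<in>J. \<phi> (u n) = val \<alpha>) \<and>
    converges_to J u \<alpha>"
  \<comment> \<open>Induction on \<open>j\<close>. After thinning out, the lists share their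
    alphabet; if it is all of \<open>B\<close>, they are thinned out further until their arches end
    in the same letter \<open>a\<close>. The arch before \<open>a\<close> belongs to the outer
    induction, and the rest, which fails richness \<open>j\<close> instead of \<open>Suc j\<close>,
    to the inner one.\<close>
  have bounded: "?goal u I"
    if "infinite I" "\<forall>n\<in>I. u n \<in> lists B \<and> \<not> rich B j (u n)" for j u I
    using that
  proof (induction j arbitrary: u I)
    case 0
    obtain n where "n \<in> I" using infinite_imp_nonempty[OF 0(1)] by blast
    then have "\<not> rich B 0 (u n)" using 0(2) by blast
    then show ?case by (simp add: rich_def)
  next
    case (Suc j)
    have "finite ((\<lambda>n. set (u n)) ` I)"
      using Suc.prems(2) by (intro finite_subset[OF _ finite_Pow_iff[THEN iffD2, OF psubset.hyps(1)]]) auto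
    from pigeonhole_infinite[OF Suc.prems(1) this]
    obtain n0 where "n0 \<in> I" and inf: "infinite {n\<in>I. set (u n) = set (u n0)}" by blast
    define I1 where "I1 = {n\<in>I. set (u n) = set (u n0)}"
    have I1: "infinite I1" "I1 \<subseteq> I" and set: "\<And>n. n \<in> I1 \<Longrightarrow> set (u n) = set (u n0)"
      using inf by (auto simp: I1_def)
    have "set (u n0) \<subseteq> B" using Suc.prems(2)[rule_format, OF \<open>n0 \<in> I\<close>] by auto
    show ?case
    proof (cases "set (u n0) = B")
      case False
      with \<open>set (u n0) \<subseteq> B\<close> have sub: "set (u n0) \<subset> B" "set (u n0) \<subseteq> \<Sigma>"
        using psubset.prems(1) by blast+
      have "\<forall>n\<in>I1. u n \<in> lists (set (u n0))"
        using set by (simp add: lists_eq_set)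
      from psubset.IH[OF sub I1(1), of u, OF this]
      obtain J \<alpha> where "J \<subseteq> I1" "infinite J" "set_pterm \<alpha> \<subseteq> set (u n0)" "\<forall>n\<in>J. \<phi> (u n) = val \<alpha>"
        "converges_to J u \<alpha>" by (elim exE conjE) (rule that; assumption)
      then show ?thesis
        using I1(2) \<open>set (u n0) \<subseteq> B\<close> by (intro exI[of _ J] exI[of _ \<alpha>]) auto
    next
      case True
      have "B \<noteq> {}"
      proof
        assume "B = {}"
        then have "rich B (Suc j) (u n0)" by (auto simp: rich_def)
        then show False using Suc.prems(2)[rule_format, OF \<open>n0 \<in> I\<close>] by blast
      qed
      have "\<exists>a. a \<in> set (u n) \<and> set (near_list True a (u n)) = set (u n) - {a}" if "n \<in> I1" for n
        using exists_arch[of "u n" True] set[OF that] True \<open>B \<noteq> {}\<close> by metis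
      then obtain h where h: "\<And>n. n \<in> I1 \<Longrightarrow> h n \<in> set (u n)"
        "\<And>n. n \<in> I1 \<Longrightarrow> set (near_list True (h n) (u n)) = set (u n) - {h n}" by metis
      have hB: "h ` I1 \<subseteq> B" using h(1) set True by auto
      from pigeonhole_infinite[OF I1(1) finite_subset[OF hB psubset.hyps(1)]]
      obtain n1 where "n1 \<in> I1" "infinite {n\<in>I1. h n = h n1}" by blast
      define a where "a = h n1"
      define I2 where "I2 = {n\<in>I1. h n = a}"
      have I2: "infinite I2" "I2 \<subseteq> I1" "\<And>n. n \<in> I2 \<Longrightarrow> h n = a"
        using \<open>infinite {n\<in>I1. h n = h n1}\<close> by (simp_all add: I2_def a_def)
      define w where "w n = near_list True a (u n)" for n
      define r where "r n = far_list True a (u n)" for n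
      have arch: "a \<in> set (u n)" "set (w n) = B - {a}" if "n \<in> I2" for n
      proof -
        have n: "n \<in> I1" "h n = a" using that I2 by blast+
        show "a \<in> set (u n)" "set (w n) = B - {a}"
          using h[OF n(1)] set[OF n(1)] True unfolding n(2) w_def by auto
      qed
      have eq: "u n = w n @ [a] @ r n" if "n \<in> I2" for n
        using list_eq_near_far(1)[OF arch(1)[OF that], of True] by (simp add: app_def w_def r_def)
      have uB: "set (u n) = B" if "n \<in> I2" for n using set I2(2) that True by blast
      have rB: "r n \<in> lists B" if "n \<in> I2" for n
        using eq[OF that] uB[OF that] by (auto simp: in_lists_conv_set)
      have aB: "a \<in> B"
      proof -
        obtain n where "n \<in> I2" using infinite_imp_nonempty[OF I2(1)] by blast
        then show ?thesis using arch(1) uB by blast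
      qed
      then have "B - {a} \<subset> B" "B - {a} \<subseteq> \<Sigma>" using psubset.prems(1) by blast+
      moreover have "\<forall>n\<in>I2. w n \<in> lists (B - {a})"
        using arch(2) by (simp add: lists_eq_set)
      note psubset.IH[OF calculation I2(1), of w, OF this]
      then obtain J \<alpha> where J: "J \<subseteq> I2" "infinite J" and \<alpha>: "set_pterm \<alpha> \<subseteq> B - {a}"
        "\<forall>n\<in>J. \<phi> (w n) = val \<alpha>" "converges_to J w \<alpha>"
        by (elim exE conjE) (rule that; assumption)
      have "r n \<in> lists B \<and> \<not> rich B j (r n)" if "n \<in> J" for n
      proof -
        have n: "n \<in> I2" "n \<in> I" using that J(1) I2(2) I1(2) by blast+
        have "\<not> rich B j (r n)"
          using rich_SucI[of a "u n" B j] arch[OF n(1)] Suc.prems(2)[rule_format, OF n(2)] unfolding r_def w_def by blast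
        then show ?thesis using rB[OF n(1)] by blast
      qed
      then have "\<forall>n\<in>J. r n \<in> lists B \<and> \<not> rich B j (r n)" by blast
      from Suc.IH[OF J(2), of r, OF this]
      obtain K \<beta> where K: "K \<subseteq> J" "infinite K" and \<beta>: "set_pterm \<beta> \<subseteq> B"
        "\<forall>n\<in>K. \<phi> (r n) = val \<beta>" "converges_to K r \<beta>"
        by (elim exE conjE) (rule that; assumption)
      let ?\<gamma> = "Cat \<alpha> (Cat (Letter a) \<beta>)"
      have \<Sigma>: "set_pterm \<alpha> \<subseteq> \<Sigma>" "set_pterm \<beta> \<subseteq> \<Sigma>" "a \<in> \<Sigma>"
        using \<alpha>(1) \<beta>(1) aB psubset.prems(1) by auto
      have "\<phi> (u n) = val ?\<gamma>" if "n \<in> K" for n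
      proof -
        have n: "n \<in> I2" "n \<in> J" using that K J by blast+
        have l: "w n \<in> lists \<Sigma>" "[a] \<in> lists \<Sigma>" "r n \<in> lists \<Sigma>"
          using arch(2)[OF n(1)] rB[OF n(1)] \<Sigma>(3) psubset.prems(1) by (auto simp: in_lists_conv_set)
        have "\<phi> ([a] @ r n) = \<phi> [a] * \<phi> (r n)" by (rule hom_append[OF l(2,3)])
        moreover have "\<phi> (w n @ ([a] @ r n)) = \<phi> (w n) * \<phi> ([a] @ r n)"
          using l by (intro hom_append) auto
        ultimately show ?thesis
          using \<alpha>(2) \<beta>(2) n(2) that \<Sigma> by (simp add: eq[OF n(1)] val_Cat)
      qed
      moreover have "converges_to K u ?\<gamma>"
      proof -
        have "converges_to K (\<lambda>n. w n @ [a] @ r n) ?\<gamma>"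
          by (intro converges_to_Cat converges_to_Letter \<beta>(3) converges_to_subset[OF \<alpha>(3) K(1)])
        moreover have "w n @ [a] @ r n = u n" if "n \<in> K" for n using eq that K J by auto
        ultimately show ?thesis by (rule converges_to_cong[rotated])
      qed
      moreover have "set_pterm ?\<gamma> \<subseteq> B" using \<alpha>(1) \<beta>(1) aB by auto
      moreover have "K \<subseteq> I" using K J I2 I1 by blast
      ultimately show ?thesis using K(2) by blast
    qed
  qed
  show ?case
  proof (cases "\<exists>j. infinite {n\<in>I. \<not> rich B j (u n)}")
    case True
    then obtain j where "infinite {n\<in>I. \<not> rich B j (u n)}" by blast
    moreover have "\<forall>n\<in>{n\<in>I. \<not> rich B j (u n)}. u n \<in> lists B \<and> \<not> rich B j (u n)"
      using psubset.prems(3) by blast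
    note bounded[OF calculation, of u j, OF this]
    then obtain J \<alpha> where
      "J \<subseteq> {n\<in>I. \<not> rich B j (u n)}" "infinite J" "set_pterm \<alpha> \<subseteq> B" "\<forall>n\<in>J. \<phi> (u n) = val \<alpha>"
      "converges_to J u \<alpha>" by (elim exE conjE) (rule that; assumption)
    then show ?thesis by (intro exI[of _ J] exI[of _ \<alpha>]) auto
  next
    case False
    have "finite ((\<lambda>n. \<phi> (u n)) ` I)" by simp
    from pigeonhole_infinite[OF psubset.prems(2) this]
    obtain x where "infinite {n\<in>I. \<phi> (u n) = x}" by blast
    define J where "J = {n\<in>I. \<phi> (u n) = x}"
    have J: "infinite J" "J \<subseteq> I" "\<And>n. n \<in> J \<Longrightarrow> \<phi> (u n) = x"
      using \<open>infinite {n\<in>I. \<phi> (u n) = x}\<close> by (auto simp: J_def)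
    have fin: "finite {n\<in>J. \<not> rich B j (u n)}" for j
    proof (rule finite_subset)
      show "finite {n\<in>I. \<not> rich B j (u n)}" using False by blast
    qed (use J(2) in blast)
    \<comment> \<open>Only finitely many indices of \<open>J\<close> fail richness \<open>j\<close>,
      so some list of the common value \<open>x\<close> has it.\<close>
    have "\<exists>w\<in>lists B. rich B j w \<and> \<phi> w = x" for j
    proof -
      have "infinite (J - {n\<in>J. \<not> rich B j (u n)})" using J(1) fin by (rule Diff_infinite_finite[rotated])
      then obtain n where "n \<in> J" "rich B j (u n)" using infinite_imp_nonempty by blast
      then show ?thesis using J psubset.prems(3) by blast
    qed
    from rich_term[OF psubset.prems(1) this]
    obtain \<alpha> where \<alpha>: "set_pterm \<alpha> \<subseteq> B" "subwords \<alpha> = lists B" "val \<alpha> = x" by blast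
    have "converges_to J u \<alpha>"
      unfolding converges_to_def
    proof
      fix t
      \<comment> \<open>Lists over \<open>B\<close> have subwords over \<open>B\<close> only. Hence
        a wrong answer for \<open>t\<close> means that some list of its length over
        \<open>B\<close>, namely \<open>t\<close>, is missing.\<close>
      have "{n\<in>J. subseq t (u n) \<noteq> (t \<in> subwords \<alpha>)} \<subseteq> {n\<in>J. \<not> rich B (length t) (u n)}"
      proof
        fix n assume "n \<in> {n\<in>J. subseq t (u n) \<noteq> (t \<in> subwords \<alpha>)}"
        then have n: "n \<in> J" "subseq t (u n) \<noteq> (t \<in> lists B)" using \<alpha>(2) by auto
        have "t \<in> lists B" if "subseq t (u n)"
          using subseq_imp_subset[OF that] psubset.prems(3) J(2) n(1) by (auto simp: in_lists_conv_set)
        then have "t \<in> lists B" "\<not> subseq t (u n)" using n(2) by blast+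
        then show "n \<in> {n\<in>J. \<not> rich B (length t) (u n)}" using n(1) by (auto simp: rich_def)
      qed
      then show "finite {n\<in>J. subseq t (u n) \<noteq> (t \<in> subwords \<alpha>)}" using fin by (rule finite_subset)
    qed
    then show ?thesis using J \<alpha> by (intro exI[of _ J] exI[of _ \<alpha>]) auto
  qed
qed

section \<open>Pairs of values realised by related lists and by related terms\<close>

definition list_pair_at :: "bool \<Rightarrow> nat \<Rightarrow> 'a set \<Rightarrow> 'm \<times> 'm \<Rightarrow> nat \<Rightarrow> bool" where
  "list_pair_at d m B p n \<longleftrightarrow> (\<exists>u v. set u = B \<and> set v = B \<and> list_eq d m n u v \<and> p = (\<phi> u, \<phi> v))"

definition list_pair :: "bool \<Rightarrow> nat \<Rightarrow> 'a set \<Rightarrow> 'm \<times> 'm \<Rightarrow> bool" where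
  "list_pair d m B p \<longleftrightarrow> (\<forall>n. list_pair_at d m B p n)"

lemma list_pair_at_antimono:
  assumes "list_pair_at d m B p n" "n' \<le> n"
  shows "list_pair_at d m B p n'"
proof -
  obtain u v where "set u = B" "set v = B" "list_eq d m n u v" "p = (\<phi> u, \<phi> v)"
    using assms(1) unfolding list_pair_at_def by blast
  then show ?thesis
    unfolding list_pair_at_def using factor_eq_antimono[OF \<open>list_eq d m n u v\<close> assms(2)] by blast
qed

lemma list_pairE:
  assumes "list_pair d m B p"
  obtains u v where "set u = B" "set v = B" "list_eq d m n u v" "p = (\<phi> u, \<phi> v)"
  using assms unfolding list_pair_def list_pair_at_def by blast

text \<open>One pair of terms has to work for all \<open>n\<close>, whereas in
  \<open>list_pair\<close> the lists may change with \<open>n\<close>. Bridging this gap is the aim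
  of what follows.\<close>

definition term_pair :: "bool \<Rightarrow> nat \<Rightarrow> 'a set \<Rightarrow> 'm \<times> 'm \<Rightarrow> bool" where
  "term_pair d m B p \<longleftrightarrow> (\<exists>\<alpha> \<beta>. set_pterm \<alpha> = B \<and> set_pterm \<beta> = B \<and> (\<forall>n. term_eq d m n \<alpha> \<beta>) \<and>
    p = (val \<alpha>, val \<beta>))"

text \<open>First thin out for the left lists, then within that index set for the right ones. By
  \<open>list_eq_1\<close> related lists share their short subwords, so the two limits have the same
  subwords and \<open>term_eq_1\<close> applies.\<close>

lemma list_pair_1:
  assumes B: "B \<subseteq> \<Sigma>" and p: "list_pair d (Suc 0) B p"
  shows "term_pair d (Suc 0) B p"
proof -
  obtain u v where uv: "\<And>n. set (u n) = B" "\<And>n. set (v n) = B" "\<And>n. list_eq d (Suc 0) n (u n) (v n)"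
    "\<And>n. p = (\<phi> (u n), \<phi> (v n))"
    using p unfolding list_pair_def list_pair_at_def by metis
  have finB: "finite B" using finite_subset[OF B finite_alphabet] .
  have lists: "\<forall>n\<in>I. u n \<in> lists B" "\<forall>n\<in>I. v n \<in> lists B" for I
    using uv(1,2) by (simp_all add: lists_eq_set)
  obtain J \<alpha> where J: "infinite J" "\<forall>n\<in>J. \<phi> (u n) = val \<alpha>" "converges_to J u \<alpha>"
    using converging_subsequence[OF finB B infinite_UNIV_nat lists(1)] by blast
  obtain K \<beta> where K: "K \<subseteq> J" "infinite K" "\<forall>n\<in>K. \<phi> (v n) = val \<beta>" "converges_to K v \<beta>"
    using converging_subsequence[OF finB B J(1) lists(2)] by blast
  have \<alpha>: "converges_to K u \<alpha>" by (rule converges_to_subset[OF J(3) K(1)])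
  \<comment> \<open>For one \<open>t\<close> only finitely many indices are bad, so a good index can
    be found beyond any bound. The bound \<open>length t\<close> is what \<open>list_eq_1\<close>
    asks for.\<close>
  have large: "\<exists>n\<in>K. j \<le> n \<and> (subseq t (u n) \<longleftrightarrow> t \<in> subwords \<alpha>) \<and> (subseq t (v n) \<longleftrightarrow> t \<in> subwords \<beta>)" for t j
  proof -
    have "finite ({..<j} \<union> {n\<in>K. subseq t (u n) \<noteq> (t \<in> subwords \<alpha>)} \<union>
        {n\<in>K. subseq t (v n) \<noteq> (t \<in> subwords \<beta>)})" (is "finite ?E")
      using \<alpha> K(4) unfolding converges_to_def by blast
    then have "infinite (K - ?E)" using K(2) by (rule Diff_infinite_finite)
    then obtain n where "n \<in> K - ?E" using infinite_imp_nonempty by blast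
    then show ?thesis by (intro bexI[of _ n]) auto
  qed
  have "subwords \<alpha> = subwords \<beta>"
  proof (rule set_eqI)
    fix t
    obtain n where "length t \<le> n" "subseq t (u n) \<longleftrightarrow> t \<in> subwords \<alpha>" "subseq t (v n) \<longleftrightarrow> t \<in> subwords \<beta>"
      using large[of "length t" t] by blast
    then show "t \<in> subwords \<alpha> \<longleftrightarrow> t \<in> subwords \<beta>"
      using list_eq_1[OF uv(3), of t n] by blast
  qed
  moreover have "set_pterm \<alpha> = B"
  proof (rule set_eqI)
    fix a
    obtain n where "subseq [a] (u n) \<longleftrightarrow> [a] \<in> subwords \<alpha>" using large[of 0 "[a]"] by blast
    then show "a \<in> set_pterm \<alpha> \<longleftrightarrow> a \<in> B"
      using subwords_far[of True a "[]" \<alpha>] subseq_far_list[of True a "[]" "u n"] uv(1)[of n] by simp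
  qed
  moreover have "set_pterm \<beta> = B"
  proof (rule set_eqI)
    fix a
    obtain n where "subseq [a] (v n) \<longleftrightarrow> [a] \<in> subwords \<beta>" using large[of 0 "[a]"] by blast
    then show "a \<in> set_pterm \<beta> \<longleftrightarrow> a \<in> B"
      using subwords_far[of True a "[]" \<beta>] subseq_far_list[of True a "[]" "v n"] uv(2)[of n] by simp
  qed
  moreover have "p = (val \<alpha>, val \<beta>)"
  proof -
    obtain n where "n \<in> K" using large[of 0 "[]"] by blast
    then show ?thesis using J(2) K(1,3) uv(4)[of n] by auto
  qed
  ultimately show ?thesis
    unfolding term_pair_def by (intro exI[of _ \<alpha>] exI[of _ \<beta>]) (simp add: term_eq_1)
qed

subsection \<open>Higher levels\<close>

definition mul2 :: "bool \<Rightarrow> 'm \<times> 'm \<Rightarrow> 'm \<times> 'm \<Rightarrow> 'm \<times> 'm" where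
  "mul2 d p q = (mul d (fst p) (fst q), mul d (snd p) (snd q))"

lemma term_pair_cat:
  assumes "term_pair d m B p" "term_pair d m B' q" "B \<subseteq> \<Sigma>" "B' \<subseteq> \<Sigma>"
  shows "term_pair d m (B \<union> B') (mul2 d p q)"
proof -
  obtain \<alpha> \<beta> where \<alpha>: "set_pterm \<alpha> = B" "set_pterm \<beta> = B" "\<And>n. term_eq d m n \<alpha> \<beta>" "p = (val \<alpha>, val \<beta>)"
    using assms(1) unfolding term_pair_def by blast
  obtain \<gamma> \<delta> where \<gamma>: "set_pterm \<gamma> = B'" "set_pterm \<delta> = B'" "\<And>n. term_eq d m n \<gamma> \<delta>" "q = (val \<gamma>, val \<delta>)"
    using assms(2) unfolding term_pair_def by blast
  show ?thesis
    unfolding term_pair_def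
    using assms(3,4) \<alpha> \<gamma> term_eq_cat[OF \<alpha>(3) \<gamma>(3)]
    by (intro exI[of _ "cat d \<alpha> \<gamma>"] exI[of _ "cat d \<beta> \<delta>"]) (simp add: mul2_def val_cat)
qed

lemma term_eq_refl: "term_eq d m n \<alpha> \<alpha>"
proof (induction n arbitrary: d m \<alpha>)
  case (Suc n)
  then show ?case by (cases m) simp_all
qed simp

lemma term_pair_Letter: "term_pair d m {a} (\<phi> [a], \<phi> [a])"
  unfolding term_pair_def by (intro exI[of _ "Letter a"]) (simp add: term_eq_refl)

lemma term_pair_Eps: "term_pair d m {} (1, 1)"
  unfolding term_pair_def by (intro exI[of _ Eps]) (simp add: term_eq_refl)

text \<open>Above level 1, \<open>list_eq_near_list\<close> shows that the near factors of both
  lists at the last letter \<open>a\<close> of an arch of \<open>u\<close> have the alphabet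
  \<open>B - {a}\<close>, so \<open>a\<close> ends an arch of \<open>v\<close> as well. Letter,
  alphabets and values range over a finite set, and \<open>antitone_pigeonhole\<close> makes them
  independent of \<open>n\<close>.\<close>

lemma list_pair_arch:
  assumes B: "B \<subseteq> \<Sigma>" "B \<noteq> {}" and p: "list_pair d (Suc (Suc m)) B p"
  obtains a B' q r where "a \<in> B" "B' \<subseteq> B" "list_pair d (Suc (Suc m)) (B - {a}) q"
    "list_pair d (Suc (Suc m)) B' r" "p = mul2 d (mul2 d q (\<phi> [a], \<phi> [a])) r"
proof -
  let ?e = "list_eq d (Suc (Suc m))"
  let ?P = "\<lambda>(a, B', q, r) n. p = mul2 d (mul2 d q (\<phi> [a], \<phi> [a])) r \<and>
    list_pair_at d (Suc (Suc m)) (B - {a}) q n \<and> list_pair_at d (Suc (Suc m)) B' r n"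
  let ?F = "B \<times> Pow B \<times> UNIV \<times> UNIV :: ('a \<times> 'a set \<times> ('m \<times> 'm) \<times> ('m \<times> 'm)) set"
  have "finite B" using finite_subset[OF B(1) finite_alphabet] .
  then have "finite ?F" by simp
  moreover have "\<exists>c\<in>?F. ?P c n" for n
  proof -
    \<comment> \<open>Of the two extra steps, one is spent on the cut; the other keeps the index of
      the factors positive, so that their alphabets agree.\<close>
    obtain u v where uv: "set u = B" "set v = B" "?e (Suc (Suc n)) u v" "p = (\<phi> u, \<phi> v)"
      using p by (rule list_pairE)
    obtain a where a: "a \<in> set u" "set (near_list d a u) = set u - {a}"
      using exists_arch[of u d] uv(1) B(2) by metis
    have av: "a \<in> set v" using a(1) uv by simp
    let ?u = "near_list d a u" and ?u' = "far_list d a u"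
    let ?v = "near_list d a v" and ?v' = "far_list d a v"
    have near: "?e (Suc n) ?u ?v" by (rule list_eq_near_list[OF uv(3) a(1)])
    have far: "?e (Suc n) ?u' ?v'" by (rule factor_eq_SucD(4)[OF uv(3) a(1)])
    have sets: "set ?u = B - {a}" "set ?v = B - {a}"
      using factor_eq_SucD(1)[OF near] a(2) uv(1) by simp_all
    note equ = list_eq_near_far(1)[OF a(1), of d] and eqv = list_eq_near_far(1)[OF av, of d]
    have "set ?u' \<subseteq> B"
    proof -
      have "set (app d ?u (app d [a] ?u')) = B" by (simp only: equ[symmetric] uv(1))
      then show ?thesis unfolding set_app by blast
    qed
    have \<phi>_app: "\<phi> (app d x (app d [a] y)) = mul d (mul d (\<phi> x) (\<phi> [a])) (\<phi> y)"
      if "set x \<subseteq> B" "set y \<subseteq> B" for x y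
    proof -
      have "set x \<subseteq> \<Sigma>" "set [a] \<subseteq> \<Sigma>" "set y \<subseteq> \<Sigma>" using that a(1) uv(1) B(1) by auto
      then have "\<phi> (app d [a] y) = mul d (\<phi> [a]) (\<phi> y)"
        "\<phi> (app d x (app d [a] y)) = mul d (\<phi> x) (\<phi> (app d [a] y))"
        by (simp_all only: hom_app set_app Un_least)
      then show ?thesis by (simp add: mul_assoc)
    qed
    have "set ?v' = set ?u'" using factor_eq_SucD(1)[OF far] by simp
    have "\<phi> u = mul d (mul d (\<phi> ?u) (\<phi> [a])) (\<phi> ?u')"
      by (rule trans[OF arg_cong[OF equ, of \<phi>] \<phi>_app]) (simp_all add: sets(1) \<open>set ?u' \<subseteq> B\<close>)
    moreover have "\<phi> v = mul d (mul d (\<phi> ?v) (\<phi> [a])) (\<phi> ?v')"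
      by (rule trans[OF arg_cong[OF eqv, of \<phi>] \<phi>_app]) (simp_all add: sets(2) \<open>set ?u' \<subseteq> B\<close> \<open>set ?v' = set ?u'\<close> Diff_subset)
    ultimately have "p = mul2 d (mul2 d (\<phi> ?u, \<phi> ?v) (\<phi> [a], \<phi> [a])) (\<phi> ?u', \<phi> ?v')"
      using uv(4) by (simp add: mul2_def)
    moreover have "?e n ?u ?v" "?e n ?u' ?v'"
      using factor_eq_antimono[OF near, of n] factor_eq_antimono[OF far, of n] by simp_all
    moreover have "list_pair_at d (Suc (Suc m)) (B - {a}) (\<phi> ?u, \<phi> ?v) n"
      unfolding list_pair_at_def using sets calculation(2) by blast
    moreover have "list_pair_at d (Suc (Suc m)) (set ?u') (\<phi> ?u', \<phi> ?v') n"
      unfolding list_pair_at_def using \<open>set ?v' = set ?u'\<close> calculation(3) by blast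
    ultimately have "?P (a, set ?u', (\<phi> ?u, \<phi> ?v), (\<phi> ?u', \<phi> ?v')) n"
      unfolding prod.case by (intro conjI)
    moreover have "(a, set ?u', (\<phi> ?u, \<phi> ?v), (\<phi> ?u', \<phi> ?v')) \<in> ?F"
      using \<open>set ?u' \<subseteq> B\<close> a(1) uv(1) by simp
    ultimately show ?thesis by blast
  qed
  moreover have "?P c n'" if "?P c n" "n' \<le> n" for c n n'
  proof -
    obtain a B' q r where c: "c = (a, B', q, r)" by (cases c)
    show ?thesis
      using that(1) unfolding c prod.case
      by (elim conjE) (intro conjI list_pair_at_antimono[OF _ that(2)])
  qed
  ultimately have "\<exists>c\<in>?F. \<forall>n. ?P c n"
    by (rule antitone_pigeonhole)
  then obtain c where c: "c \<in> ?F" "\<forall>n. ?P c n" ..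
  obtain a B' q r where eq: "c = (a, B', q, r)" by (cases c)
  show ?thesis
  proof (rule that)
    show "a \<in> B" "B' \<subseteq> B" using c(1) unfolding eq by simp_all
    note c2 = c(2)[unfolded eq prod.case, rule_format]
    show "list_pair d (Suc (Suc m)) (B - {a}) q"
      unfolding list_pair_def by (rule allI) (rule c2[THEN conjunct2, THEN conjunct1])
    show "list_pair d (Suc (Suc m)) B' r"
      unfolding list_pair_def by (rule allI) (rule c2[THEN conjunct2, THEN conjunct2])
    show "p = mul2 d (mul2 d q (\<phi> [a], \<phi> [a])) r" by (rule c2[THEN conjunct1])
  qed
qed

lemma term_pair_if_list_pair:
  assumes "B \<subseteq> \<Sigma>" "list_pair d (Suc m) B p"
  shows "term_pair d (Suc m) B p"
  using assms
proof (induction m arbitrary: d B p)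
  case 0
  then show ?case by (rule list_pair_1)
next
  case (Suc m)
  \<comment> \<open>Passing from lists to terms one level lower, with the direction turned: this is
    what a tail behind a power has to satisfy.\<close>
  have level: "term_pair (\<not> d) (Suc m) B p" if B: "B \<subseteq> \<Sigma>" and p: "list_pair d (Suc (Suc m)) B p" for B p
  proof (rule Suc.IH[OF B])
    show "list_pair (\<not> d) (Suc m) B p"
      unfolding list_pair_def
    proof
      fix n
      obtain u v where uv: "set u = B" "set v = B" "list_eq d (Suc (Suc m)) (Suc n) u v" "p = (\<phi> u, \<phi> v)"
        using p by (rule list_pairE)
      then show "list_pair_at (\<not> d) (Suc m) B p n"
        unfolding list_pair_at_def using factor_eq_SucD(2)[OF uv(3)] by blast
    qed
  qed
  have "finite B" using finite_subset[OF Suc.prems(1) finite_alphabet] .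
  then show ?case
    using Suc.prems
  proof (induction B arbitrary: p rule: finite_psubset_induct)
    case (psubset B)
    show ?case
    proof (cases "B = {}")
      case True
      then have "p = (1, 1)" using psubset.prems(2) by (auto simp: hom_Nil elim: list_pairE)
      then show ?thesis using True term_pair_Eps by simp
    next
      case False
      \<comment> \<open>A remainder may have lost letters, hence the subsets in \<open>?T\<close>
        and \<open>?C\<close>; a piece cut off in front has the full alphabet
        \<open>B\<close>.\<close>
      let ?T = "\<lambda>p. \<exists>B'\<subseteq>B. list_pair d (Suc (Suc m)) B' p"
      let ?C = "\<lambda>p. \<exists>B'\<subseteq>B. term_pair d (Suc (Suc m)) B' p"
      let ?D = "term_pair d (Suc (Suc m)) B"
      have step: "\<exists>q r. ?D q \<and> ?T r \<and> p = mul2 d q r" if B_p: "list_pair d (Suc (Suc m)) B p" for p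
      proof -
        obtain a B' q r where a: "a \<in> B" "B' \<subseteq> B" and q: "list_pair d (Suc (Suc m)) (B - {a}) q"
          and r: "list_pair d (Suc (Suc m)) B' r" and p: "p = mul2 d (mul2 d q (\<phi> [a], \<phi> [a])) r"
          using list_pair_arch[OF psubset.prems(1) False B_p] .
        have "B - {a} \<subset> B" "B - {a} \<subseteq> \<Sigma>" "{a} \<subseteq> \<Sigma>" using a psubset.prems(1) by blast+
        note term_pair_cat[OF psubset.IH[OF this(1,2) q] term_pair_Letter[of d "Suc (Suc m)" a] this(2,3)]
        moreover have "B - {a} \<union> {a} = B" using a(1) by blast
        ultimately have "?D (mul2 d q (\<phi> [a], \<phi> [a]))" by simp
        then show ?thesis using a(2) r p by blast
      qed
      have C: "?C p" if "?T p" for p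
      proof (rule factorization_loop[where f = "mul2 d" and e = "(1, 1)" and T = ?T and C = ?C and D = ?D])
        show "mul2 d (mul2 d x y) z = mul2 d x (mul2 d y z)" for x y z
          by (simp add: mul2_def mul_assoc)
        show "mul2 d (1, 1) x = x" "mul2 d x (1, 1) = x" for x
          by (simp_all add: mul2_def)
        show "?C x \<or> (\<exists>p t. ?D p \<and> ?T t \<and> x = mul2 d p t)" if T_x: "?T x" for x
        proof -
          obtain B' where B': "B' \<subseteq> B" "list_pair d (Suc (Suc m)) B' x" using T_x by blast
          show ?thesis
          proof (cases "B' = B")
            case True
            then show ?thesis using step B'(2) by blast
          next
            case False
            then have "B' \<subset> B" "B' \<subseteq> \<Sigma>" using B'(1) psubset.prems(1) by auto
            from psubset.IH[OF this B'(2)] show ?thesis using B'(1) by blast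
          qed
        qed
        show "?D (mul2 d p q)" if "?D p" "?D q" for p q
          using term_pair_cat[OF that psubset.prems(1) psubset.prems(1)] by simp
        show "?C (mul2 d p x)" if "?D p" "?C x" for p x
        proof -
          obtain B' where B': "B' \<subseteq> B" "term_pair d (Suc (Suc m)) B' x" using \<open>?C x\<close> by blast
          then have "B' \<subseteq> \<Sigma>" using psubset.prems(1) by blast
          from term_pair_cat[OF \<open>?D p\<close> B'(2) psubset.prems(1) this] show ?thesis
            using B'(1) by (intro exI[of _ "B \<union> B'"]) simp
        qed
        \<comment> \<open>The tail \<open>t\<close> gets terms from \<open>level\<close> only,
          related at a lower level. The power of \<delta>, whose alphabet is all of
          \<open>B\<close>, shields it from direction \<open>d\<close> by
          \<open>term_eq_cat_Pi_cat\<close>.\<close>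
        show "?C (mul2 d g t)" if g: "g = (1, 1) \<or> ?D g" and s: "?D s" and gs: "mul2 d g s = g" and t: "?T t" for g s t
        proof -
          \<comment> \<open>If the loop starts before any piece was cut off, empty terms represent
            \<open>g\<close>; therefore only inclusions of alphabets are claimed.\<close>
          obtain \<rho> \<rho>' where \<rho>: "set_pterm \<rho> \<subseteq> B" "set_pterm \<rho>' \<subseteq> B"
            "\<And>n. term_eq d (Suc (Suc m)) n \<rho> \<rho>'" "g = (val \<rho>, val \<rho>')"
          proof (cases "g = (1, 1)")
            case True
            then show ?thesis by (intro that[of Eps Eps]) (simp_all add: term_eq_refl)
          next
            case False
            then have "?D g" using g by blast
            then show ?thesis using that unfolding term_pair_def by blast
          qed
          obtain \<delta> \<delta>' where \<delta>: "set_pterm \<delta> = B" "set_pterm \<delta>' = B"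
            "\<And>n. term_eq d (Suc (Suc m)) n \<delta> \<delta>'" "s = (val \<delta>, val \<delta>')"
            using s unfolding term_pair_def by blast
          obtain B' where B': "B' \<subseteq> B" "list_pair d (Suc (Suc m)) B' t" using t by blast
          then have "B' \<subseteq> \<Sigma>" using psubset.prems(1) by blast
          from level[OF this B'(2)]
          obtain \<zeta> \<zeta>' where \<zeta>: "set_pterm \<zeta> = B'" "set_pterm \<zeta>' = B'"
            "\<And>n. term_eq (\<not> d) (Suc m) n \<zeta> \<zeta>'" "t = (val \<zeta>, val \<zeta>')"
            unfolding term_pair_def by blast
          let ?\<alpha> = "cat d (cat d \<rho> (Pi \<delta>)) \<zeta>" and ?\<beta> = "cat d (cat d \<rho>' (Pi \<delta>')) \<zeta>'"
          have "term_eq d (Suc (Suc m)) n ?\<alpha> ?\<beta>" for n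
            using \<zeta>(1,2) \<delta>(1) B'(1) by (intro term_eq_cat_Pi_cat \<rho>(3) \<delta>(3) \<zeta>(3)) simp_all
          moreover have "set_pterm ?\<alpha> = B" "set_pterm ?\<beta> = B"
            using \<rho>(1,2) \<delta>(1,2) \<zeta>(1,2) B'(1) by auto
          moreover have "mul2 d g t = (val ?\<alpha>, val ?\<beta>)"
          proof -
            have "val (cat d (cat d \<rho> (Pi \<delta>)) \<zeta>) = mul d (mul d (val \<rho>) (val \<delta> ^ k)) (val \<zeta>)"
              if "set_pterm \<rho> \<subseteq> B" "set_pterm \<delta> \<subseteq> B" "set_pterm \<zeta> \<subseteq> B" for \<rho> \<delta> \<zeta>
              using that psubset.prems(1) by (subst val_cat, auto)+ (simp add: val_Pi)
            moreover have "mul d (val \<rho>) (val \<delta>) = val \<rho>" "mul d (val \<rho>') (val \<delta>') = val \<rho>'"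
              using gs by (simp_all add: mul2_def \<rho>(4) \<delta>(4))
            ultimately show ?thesis
              using \<rho>(1,2) \<delta>(1,2) \<zeta>(1,2) B'(1) by (simp add: mul2_def mul_power_absorb \<rho>(4) \<zeta>(4))
          qed
          ultimately have "?D (mul2 d g t)" unfolding term_pair_def by blast
          then show ?thesis by blast
        qed
        show "?T p" by (rule that)
      qed
      \<comment> \<open>The loop argument bounds the alphabet of its terms by \<open>B\<close> only.
        One arch cut off beforehand and put back in front makes it equal to
        \<open>B\<close>.\<close>
      obtain q r where q: "?D q" and "?T r" and p: "p = mul2 d q r" using step[OF psubset.prems(2)] by blast
      then obtain B' where B': "B' \<subseteq> B" "term_pair d (Suc (Suc m)) B' r" using C by blast
      then have "B' \<subseteq> \<Sigma>" "B \<union> B' = B" using psubset.prems(1) by blast+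
      then show ?thesis using term_pair_cat[OF q B'(2) psubset.prems(1)] p by simp
    qed
  qed
qed

end

theorem lemma14:
  fixes \<Sigma> :: "'a set"
    and \<phi> :: "'a list \<Rightarrow> 'm::{finite, monoid_mult}"
    and m :: nat
    and m\<^sub>u m\<^sub>v :: 'm
    and u v :: "nat \<Rightarrow> 'a list"
  assumes "finite \<Sigma>"
    and "\<phi> [] = 1"
    and "\<And>x y. x \<in> lists \<Sigma> \<Longrightarrow> y \<in> lists \<Sigma> \<Longrightarrow> \<phi> (x @ y) = \<phi> x * \<phi> y"
    and "\<And>n. u n \<in> lists \<Sigma>"
    and "\<And>n. v n \<in> lists \<Sigma>"
    and "\<And>n. eqX m n (word_of_list (u n)) (word_of_list (v n))"
    and "\<And>n. \<phi> (u n) = m\<^sub>u"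
    and "\<And>n. \<phi> (v n) = m\<^sub>v"
  shows "\<exists>\<alpha> \<beta>. set_pterm \<alpha> \<subseteq> \<Sigma> \<and> set_pterm \<beta> \<subseteq> \<Sigma> \<and>
    \<phi> (list_of_word (interp (fin_order (monoid_fact TYPE('m))) \<alpha>)) = m\<^sub>u \<and>
    \<phi> (list_of_word (interp (fin_order (monoid_fact TYPE('m))) \<beta>)) = m\<^sub>v \<and>
    eqX_lim m (interp omega_omega_star \<alpha>) (interp omega_omega_star \<beta>)"
proof -
  interpret word_hom \<Sigma> \<phi> "monoid_fact TYPE('m)"
    by unfold_locales (fact assms(1-3))+
  have "\<exists>\<alpha> \<beta>. set_pterm \<alpha> \<subseteq> \<Sigma> \<and> set_pterm \<beta> \<subseteq> \<Sigma> \<and> val \<alpha> = m\<^sub>u \<and> val \<beta> = m\<^sub>v \<and>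
    (\<forall>n. term_eq True m n \<alpha> \<beta>)"
  proof (cases m)
    case 0
    \<comment> \<open>At level 0 nothing is compared, so the words with index 0 serve as
      terms.\<close>
    then show ?thesis
      using assms(4,5,7,8)[of 0]
      by (intro exI[of _ "word_term (u 0)"] exI[of _ "word_term (v 0)"]) (auto simp: in_lists_conv_set)
  next
    case (Suc m')
    have eq: "list_eq True m n (u n) (v n)" for n
      using assms(6) by (simp add: eqX_word_of_list)
    let ?P = "\<lambda>B. list_pair_at True m B (m\<^sub>u, m\<^sub>v)"
    \<comment> \<open>The common alphabet of the two words may depend on \<open>n\<close> and is
      fixed by the pigeonhole. The words with index \<open>Suc n\<close> are taken because the
      relation forces equal alphabets for positive indices only.\<close>
    have "\<exists>B\<in>Pow \<Sigma>. ?P B n" for n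
    proof
      show "set (u (Suc n)) \<in> Pow \<Sigma>" using assms(4) by (auto simp: in_lists_conv_set)
      have "set (v (Suc n)) = set (u (Suc n))"
        using factor_eq_SucD(1)[OF eq[of "Suc n", unfolded Suc]] by simp
      moreover have "list_eq True m n (u (Suc n)) (v (Suc n))"
        by (rule factor_eq_antimono[OF eq]) simp
      ultimately show "?P (set (u (Suc n))) n"
        unfolding list_pair_at_def using assms(7,8) by (intro exI[of _ "u (Suc n)"] exI[of _ "v (Suc n)"]) simp
    qed
    then have "\<exists>B\<in>Pow \<Sigma>. \<forall>n. ?P B n"
    proof (rule antitone_pigeonhole[rotated])
      show "?P B n'" if "?P B n" "n' \<le> n" for B n n'
        using that by (rule list_pair_at_antimono)
    qed (simp add: assms(1))
    then obtain B where "B \<in> Pow \<Sigma>" "\<And>n. ?P B n" by blast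
    then have "term_pair True m B (m\<^sub>u, m\<^sub>v)"
      using \<open>B \<in> Pow \<Sigma>\<close> unfolding Suc by (intro term_pair_if_list_pair) (auto simp only: list_pair_def Pow_iff)
    then show ?thesis
      using \<open>B \<in> Pow \<Sigma>\<close> unfolding term_pair_def by auto
  qed
  then obtain \<alpha> \<beta> where "set_pterm \<alpha> \<subseteq> \<Sigma>" "set_pterm \<beta> \<subseteq> \<Sigma>" "val \<alpha> = m\<^sub>u" "val \<beta> = m\<^sub>v"
    "\<forall>n. term_eq True m n \<alpha> \<beta>" by blast
  then show ?thesis
    unfolding list_of_word_interp val_def eqX_lim_def eqX_omega_word by blast
qed

end
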